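(* Let $n \geq 9$ and let $k \in \{1, 2, \dotsc, \lfloor n/2 \rfloor\}$. Then there exists a constant $a_k = \frac{n}{k} + \alpha_k$ with $|\alpha_k| \leq \frac{10}{n}$ such that \[ Q - \mathbbm{1} \;\subset\; P_k - \mathbbm{1} \;\subset\; a_k\,(Q - \mathbbm{1}). \]
   Context: Let $N = n(n-1)/2$ and index the coordinates of $\mathbb{R}^N$ by unordered pairs $\{i,j\}$ of distinct elements of $\{1,\dotsc,n\}$ (write $x_{ij}=x_{ji}$ for the $\{i,j\}$ coordinate). Let $X \subset \mathbb{R}^N$ be the set of incidence vectors of Hamiltonian cycles of the complete graph $K_n$: $x_{ij}=1$ if the cycle contains edge $\{i,j\}$ and $0$ otherwise ($|X| = (n-1)!/2$). Define $Q = \{ f: X \to \mathbb{R} : f \text{ is the restriction to } X \text{ of a linear function on } \mathbb{R}^N,\ f(x)\ge 0 \ \forall x\in X,\ \frac{1}{|X|}\sum_{x\in X} f(x) = 1\}$. For a function $f:X\to\mathbb{R}$, let $q_f$ be the quadratic form on the space $\mathcal{P}_k(\mathbb{R}^N)$ of real polynomials of degree at most $k$ on $\mathbb{R}^N$ given by $q_f(h) = \frac{1}{|X|}\sum_{x\in X} f(x) h(x)^2$. Define $P_k$ as the set of all $f:X\to\mathbb{R}$ that are restrictions to $X$ of linear functions on $\mathbb{R}^N$, have average value $1$ on $X$, and for which $q_f$ is positive semidefinite on $\mathcal{P}_k(\mathbb{R}^N)$. Let $\mathbbm{1}$ denote the constant function $1$ on $X$ (it is the restriction of the linear function $x \mapsto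 \frac1n\sum_{i<j} x_{ij}$). Sets of functions are translated and scaled pointwise: $S - \mathbbm{1} = \{f - \mathbbm{1}: f\in S\}$, $aS = \{af : f \in S\}$. *)

theory Defs
  imports Complex_Main "HOL-Library.FuncSet" "HOL-Library.Multiset"
begin

text \<open>Vertices are 1..n; coordinates of R^N are indexed by the edges of K_n,
  i.e. the 2-element subsets of {1..n}. A point of R^N is a function
  nat set \<Rightarrow> real (only its values on edges matter).\<close>

definition edges :: "nat \<Rightarrow> nat set set" where
  "edges n = {e. e \<subseteq> {1..n} \<and> card e = 2}"

definition ham_cycles :: "nat \<Rightarrow> nat set set set" where
  "ham_cycles n = {C. \<exists>p. bij_betw p {..<n} {1..n} \<and>
                        C = {{p i, p (Suc i mod n)} | i. i < n}}"

definition HX :: "nat \<Rightarrow> (nat set \<Rightarrow> real) set" where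
  "HX n = (\<lambda>C e. if e \<in> C then 1 else 0) ` ham_cycles n"

definition avg :: "'a set \<Rightarrow> ('a \<Rightarrow> real) \<Rightarrow> real" where
  "avg A g = (\<Sum>x\<in>A. g x) / real (card A)"

definition lin_fun :: "nat \<Rightarrow> (nat set \<Rightarrow> real) \<Rightarrow> (nat set \<Rightarrow> real) \<Rightarrow> real" where
  "lin_fun n c x = (\<Sum>e\<in>edges n. c e * x e)"

definition poly_le :: "nat \<Rightarrow> nat \<Rightarrow> ((nat set \<Rightarrow> real) \<Rightarrow> real) \<Rightarrow> bool" where
  "poly_le n k h \<longleftrightarrow> (\<exists>c :: nat set multiset \<Rightarrow> real. \<forall>x.
      h x = (\<Sum>m\<in>{m. set_mset m \<subseteq> edges n \<and> size m \<le> k}. c m * (\<Prod>e\<in>#m. x e)))"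

text \<open>Functions X \<rightarrow> R are represented as extensional functions (restrict to X).\<close>
definition Qset :: "nat \<Rightarrow> ((nat set \<Rightarrow> real) \<Rightarrow> real) set" where
  "Qset n = {f. \<exists>c. f = (\<lambda>x\<in>HX n. lin_fun n c x)
                  \<and> (\<forall>x\<in>HX n. f x \<ge> 0) \<and> avg (HX n) f = 1}"

definition qform :: "nat \<Rightarrow> ((nat set \<Rightarrow> real) \<Rightarrow> real) \<Rightarrow> ((nat set \<Rightarrow> real) \<Rightarrow> real) \<Rightarrow> real" where
  "qform n f h = avg (HX n) (\<lambda>x. f x * (h x)^2)"

definition Pset :: "nat \<Rightarrow> nat \<Rightarrow> ((nat set \<Rightarrow> real) \<Rightarrow> real) set" where
  "Pset n k = {f. \<exists>c. f = (\<lambda>x\<in>HX n. lin_fun n c x) \<and> avg (HX n) f = 1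
                  \<and> (\<forall>h. poly_le n k h \<longrightarrow> qform n f h \<ge> 0)}"

definition shift1 :: "nat \<Rightarrow> ((nat set \<Rightarrow> real) \<Rightarrow> real) set \<Rightarrow> ((nat set \<Rightarrow> real) \<Rightarrow> real) set" where
  "shift1 n S = (\<lambda>f. \<lambda>x\<in>HX n. f x - 1) ` S"

definition scaleS :: "nat \<Rightarrow> real \<Rightarrow> ((nat set \<Rightarrow> real) \<Rightarrow> real) set \<Rightarrow> ((nat set \<Rightarrow> real) \<Rightarrow> real) set" where
  "scaleS n a S = (\<lambda>f. \<lambda>x\<in>HX n. a * f x) ` S"

end

theory Submission
  imports Defs "HOL-Library.Disjoint_Sets" "HOL-Combinatorics.Permutations"
begin

text \<open>Testing \<open>q\<^sub>f\<close> on the monomial \<open>\<Prod>e\<in>S. x e\<close>, for a matching \<open>S\<close> with \<open>k\<close> edges, shows that \<open>f\<close> has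
  nonnegative average over the Hamiltonian cycles containing \<open>S\<close>. Conditioned on containing \<open>S\<close>, a
  random Hamiltonian cycle uses an edge \<open>{u, v}\<close> outside \<open>S\<close> with probability
  \<open>w u * w v / (2 * (n - 1 - k))\<close>, where \<open>w\<close> is \<open>1\<close> on the vertices covered by \<open>S\<close> and \<open>2\<close> elsewhere.

  Fix a Hamiltonian cycle \<open>x\<close> and average these conditional expectations over all \<open>k\<close>-subsets \<open>S\<close> of all
  matchings obtained by taking every other edge of \<open>x\<close>. All chords of \<open>x\<close> get the same weight, so do
  all edges of \<open>x\<close>, and hence the average is \<open>\<lambda> x + (1 - \<lambda>) y\<close> with \<open>y\<close> the barycentre of \<open>X\<close>. Therefore
  \<open>\<lambda> * f x + (1 - \<lambda>) \<ge> 0\<close>, that is \<open>f x - 1 \<ge> - 1 / \<lambda>\<close>, and one may take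
  \<open>a = n / k + 10 / n\<close> because \<open>1 / \<lambda> \<le> n / k + 10 / n\<close>.\<close>

section \<open>Hamiltonian cycles as images of a standard cycle under permutations\<close>

text \<open>The cyclic shift of the positions \<open>1..N\<close>, extended by the identity so that
  it is a permutation in the sense of \<open>permutes\<close>. The length \<open>N\<close> is a
  parameter of its own because a permutation of \<open>n\<close> vertices is read both as a cycle of
  length \<open>n\<close> and, with the vertex at position \<open>n\<close> dropped, as one of
  length \<open>n - 1\<close>.\<close>

definition rot :: "nat \<Rightarrow> nat \<Rightarrow> nat" where
  "rot N j = (if j \<in> {1..N} then if j = N then 1 else Suc j else j)"

definition perm_edge :: "nat \<Rightarrow> (nat \<Rightarrow> nat) \<Rightarrow> nat \<Rightarrow> nat set" where
  "perm_edge N \<pi> j = \<pi> ` {j, rot N j}"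

definition perm_cycle :: "nat \<Rightarrow> (nat \<Rightarrow> nat) \<Rightarrow> nat set set" where
  "perm_cycle N \<pi> = perm_edge N \<pi> ` {1..N}"

lemma rot_permutes: "rot N permutes {1..N}"
proof (rule bij_imp_permutes)
  have "inj_on (rot N) {1..N}"
    by (auto simp: inj_on_def rot_def split: if_splits)
  moreover have "rot N ` {1..N} \<subseteq> {1..N}"
    by (auto simp: rot_def)
  ultimately show "bij_betw (rot N) {1..N} {1..N}"
    by (simp add: bij_betw_def endo_inj_surj)
qed (auto simp: rot_def)

lemma perm_edge_comp_rot: "perm_edge N (\<pi> \<circ> rot N) j = perm_edge N \<pi> (rot N j)"
  by (simp add: perm_edge_def)

lemma perm_cycle_comp_rot: "perm_cycle N (\<pi> \<circ> rot N) = perm_cycle N \<pi>"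
proof -
  have "perm_cycle N (\<pi> \<circ> rot N) = perm_edge N \<pi> ` rot N ` {1..N}"
    by (simp add: perm_cycle_def perm_edge_comp_rot image_image)
  then show ?thesis
    using permutes_image[OF rot_permutes] by (simp add: perm_cycle_def)
qed

lemma perm_cycle_comp: "perm_cycle N (\<tau> \<circ> \<pi>) = (`) \<tau> ` perm_cycle N \<pi>"
  by (auto simp: perm_cycle_def perm_edge_def image_image)

text \<open>Equal edges at different positions would make \<open>rot N\<close> exchange two
  positions, which a cyclic shift of length at least three cannot do.\<close>

lemma inj_on_perm_edge:
  assumes "inj \<pi>" "N \<ge> 3"
  shows "inj_on (perm_edge N \<pi>) {1..N}"
proof -
  have eq: "i = j" if "1 \<le> i" "i \<le> N" "1 \<le> j" "j \<le> N" "{i, rot N i} = {j, rot N j}" for i j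
  proof -
    have "rot N i = (if i = N then 1 else i + 1)" "rot N j = (if j = N then 1 else j + 1)"
      using that by (simp_all add: rot_def)
    moreover have "i = j \<or> i = rot N j \<and> rot N i = j"
      using that(5) by (simp only: doubleton_eq_iff) metis
    ultimately show ?thesis using that(1-4) assms(2) by (auto split: if_splits)
  qed
  show ?thesis
  proof (rule inj_onI)
    fix i j assume "i \<in> {1..N}" "j \<in> {1..N}" "perm_edge N \<pi> i = perm_edge N \<pi> j"
    then show "i = j"
      unfolding perm_edge_def inj_image_eq_iff[OF assms(1)] by (simp only: eq atLeastAtMost_iff)
  qed
qed

text \<open>The edges at \<open>\<pi> x\<close> sit at position \<open>x\<close> and at its cyclic
  predecessor. The set \<open>A\<close> may be larger than \<open>{1..N}\<close>, so that the count
  also applies to shortened cycles.\<close>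

lemma card_perm_edge_incident:
  assumes \<pi>: "\<pi> permutes A" "{1..N} \<subseteq> A" and v: "v \<in> \<pi> ` {1..N}" and "N \<ge> 3"
  shows "card {j\<in>{1..N}. v \<in> perm_edge N \<pi> j} = 2"
proof -
  from v obtain x where x: "x \<in> {1..N}" "v = \<pi> x" by auto
  have "inj \<pi>" using \<pi>(1) by (rule permutes_inj)
  then have "{j\<in>{1..N}. v \<in> perm_edge N \<pi> j} = {j\<in>{1..N}. x \<in> {j, rot N j}}"
    by (simp only: perm_edge_def x(2) inj_image_mem_iff)
  also have "\<dots> = {x, if x = 1 then N else x - 1}"
  proof -
    have "(1 \<le> j \<and> j \<le> N) \<and> (x = j \<or> x = rot N j) \<longleftrightarrow> j = x \<or> j = (if x = 1 then N else x - 1)" for j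
    proof -
      have "rot N j = (if j = N then 1 else j + 1)" if "1 \<le> j" "j \<le> N"
        using that by (simp add: rot_def)
      then show ?thesis
        using x(1) \<open>N \<ge> 3\<close> unfolding atLeastAtMost_iff
        by (cases "x = 1"; cases "j = N"; simp; linarith)
    qed
    then show ?thesis by (simp only: set_eq_iff mem_Collect_eq atLeastAtMost_iff insert_iff empty_iff simp_thms)
  qed
  finally have eq: "{j\<in>{1..N}. v \<in> perm_edge N \<pi> j} = {x, if x = 1 then N else x - 1}" .
  have "x \<noteq> (if x = 1 then N else x - 1)"
    using x(1) \<open>N \<ge> 3\<close> by simp linarith
  then show ?thesis
    unfolding eq by (simp only: card_2_iff) metis
qed

lemma card_perm_edge_in:
  assumes "inj \<pi>" "N \<ge> 3" "S \<subseteq> perm_cycle N \<pi>"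
  shows "card {j\<in>{1..N}. perm_edge N \<pi> j \<in> S \<and> P (perm_edge N \<pi> j)} = card {e\<in>S. P e}"
proof (rule bij_betw_same_card)
  show "bij_betw (perm_edge N \<pi>) {j\<in>{1..N}. perm_edge N \<pi> j \<in> S \<and> P (perm_edge N \<pi> j)} {e\<in>S. P e}"
    unfolding bij_betw_def
  proof
    show "inj_on (perm_edge N \<pi>) {j\<in>{1..N}. perm_edge N \<pi> j \<in> S \<and> P (perm_edge N \<pi> j)}"
      by (rule inj_on_subset[OF inj_on_perm_edge[OF assms(1,2)]]) auto
    show "perm_edge N \<pi> ` {j\<in>{1..N}. perm_edge N \<pi> j \<in> S \<and> P (perm_edge N \<pi> j)} = {e\<in>S. P e}"
      using assms(3) by (auto simp: perm_cycle_def)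
  qed
qed

lemma ham_cycles_eq:
  assumes "n \<ge> 1"
  shows "ham_cycles n = perm_cycle n ` {\<pi>. \<pi> permutes {1..n}}"
proof (intro equalityI subsetI)
  fix C assume "C \<in> ham_cycles n"
  then obtain p where p: "bij_betw p {..<n} {1..n}"
    and C: "C = {{p i, p (Suc i mod n)} | i. i < n}"
    by (auto simp: ham_cycles_def)
  \<comment> \<open>The cycle is given with positions \<open>0..n-1\<close>; shifting them to
    \<open>1..n\<close> and fixing everything else turns the numbering into a permutation.\<close>
  define \<pi> where "\<pi> j = (if j \<in> {1..n} then p (j - 1) else j)" for j
  have "bij_betw (\<lambda>j. j - 1) {1..n} {..<n}"
    by (rule bij_betw_byWitness[where f' = Suc]) auto
  from bij_betw_trans[OF this p] have "bij_betw (p \<circ> (\<lambda>j. j - 1)) {1..n} {1..n}" .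
  then have "bij_betw \<pi> {1..n} {1..n}"
    by (rule bij_betw_cong[THEN iffD1, rotated]) (auto simp: \<pi>_def)
  then have "\<pi> permutes {1..n}"
    by (rule bij_imp_permutes) (auto simp: \<pi>_def)
  moreover have "C = perm_cycle n \<pi>"
  proof -
    have "C = (\<lambda>i. {p i, p (Suc i mod n)}) ` {..<n}"
      by (auto simp: C)
    also have "\<dots> = (\<lambda>i. perm_edge n \<pi> (Suc i)) ` {..<n}"
    proof (intro image_cong refl)
      fix i assume "i \<in> {..<n}"
      then show "{p i, p (Suc i mod n)} = perm_edge n \<pi> (Suc i)"
        using assms by (cases "Suc i = n") (auto simp: perm_edge_def \<pi>_def rot_def)
    qed
    also have "\<dots> = perm_edge n \<pi> ` Suc ` {..<n}"
      by (simp only: image_image)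
    also have "Suc ` {..<n} = {1..n}"
      by (auto simp: image_Suc_lessThan)
    finally show ?thesis by (simp add: perm_cycle_def)
  qed
  ultimately show "C \<in> perm_cycle n ` {\<pi>. \<pi> permutes {1..n}}" by blast
next
  fix C assume "C \<in> perm_cycle n ` {\<pi>. \<pi> permutes {1..n}}"
  then obtain \<pi> where \<pi>: "\<pi> permutes {1..n}" and C: "C = perm_cycle n \<pi>" by blast
  have "bij_betw Suc {..<n} {1..n}"
    by (rule bij_betw_byWitness[where f' = "\<lambda>j. j - 1"]) auto
  from bij_betw_trans[OF this permutes_imp_bij[OF \<pi>]]
  have "bij_betw (\<pi> \<circ> Suc) {..<n} {1..n}" .
  moreover have "C = {{(\<pi> \<circ> Suc) i, (\<pi> \<circ> Suc) (Suc i mod n)} | i. i < n}"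
  proof -
    have "Suc ` {..<n} = {1..n}"
      by (auto simp: image_Suc_lessThan)
    then have "C = (\<lambda>i. perm_edge n \<pi> (Suc i)) ` {..<n}"
      unfolding C perm_cycle_def by (simp only: image_image flip: \<open>Suc ` {..<n} = {1..n}\<close>)
    also have "\<dots> = (\<lambda>i. {(\<pi> \<circ> Suc) i, (\<pi> \<circ> Suc) (Suc i mod n)}) ` {..<n}"
    proof (intro image_cong refl)
      fix i assume "i \<in> {..<n}"
      then show "perm_edge n \<pi> (Suc i) = {(\<pi> \<circ> Suc) i, (\<pi> \<circ> Suc) (Suc i mod n)}"
        using assms by (cases "Suc i = n") (auto simp: perm_edge_def rot_def)
    qed
    finally show ?thesis by auto
  qed
  ultimately show "C \<in> ham_cycles n"
    unfolding ham_cycles_def by blast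
qed

lemma ham_cycles_image:
  assumes "C \<in> ham_cycles n" "\<tau> permutes {1..n}" "n \<ge> 1"
  shows "(`) \<tau> ` C \<in> ham_cycles n"
  using assms permutes_compose[OF _ assms(2)]
  by (auto simp: ham_cycles_eq perm_cycle_comp[symmetric])

lemma finite_ham_cycles: "n \<ge> 1 \<Longrightarrow> finite (ham_cycles n)"
  by (simp add: ham_cycles_eq finite_permutations)

lemma ham_cycles_subset_edges:
  assumes "C \<in> ham_cycles n" "n \<ge> 2"
  shows "C \<subseteq> edges n"
proof -
  obtain \<pi> where \<pi>: "\<pi> permutes {1..n}" and C: "C = perm_cycle n \<pi>"
    using assms by (auto simp: ham_cycles_eq)
  have "\<pi> ` {j, rot n j} \<in> edges n" if "j \<in> {1..n}" for j
  proof -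
    have "rot n j \<in> {1..n}" using that permutes_in_image[OF rot_permutes] by blast
    moreover have "rot n j \<noteq> j" using that assms(2) by (auto simp: rot_def)
    ultimately show ?thesis
      using that \<pi> permutes_inj[OF \<pi>] permutes_in_image[OF \<pi>]
      by (auto simp: edges_def card_image inj_eq)
  qed
  then show ?thesis by (auto simp: C perm_cycle_def perm_edge_def)
qed

lemma finite_edges: "finite (edges n)"
  by (simp add: edges_def)

section \<open>Counting cycles by numberings that end in a prescribed vertex\<close>

text \<open>Rotating a numbering leaves its cycle unchanged, and \<open>x\<close> rotations bring
  the vertex at position \<open>x\<close> to position \<open>n\<close>. With \<open>w\<close> in the
  last place, deleting \<open>w\<close> just means shortening the numbering.\<close>

lemma ham_cycles_eq_rooted:
  assumes "n \<ge> 1" "w \<in> {1..n}"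
  shows "ham_cycles n = perm_cycle n ` {\<pi>. \<pi> permutes {1..n} \<and> \<pi> n = w}"
proof -
  have "\<exists>\<sigma>. \<sigma> permutes {1..n} \<and> \<sigma> n = w \<and> perm_cycle n \<sigma> = perm_cycle n \<pi>"
    if \<pi>: "\<pi> permutes {1..n}" for \<pi>
  proof -
    have rot: "(\<pi> \<circ> (rot n ^^ t)) permutes {1..n} \<and> perm_cycle n (\<pi> \<circ> (rot n ^^ t)) = perm_cycle n \<pi>" for t
    proof (induction t)
      case (Suc t)
      have "\<pi> \<circ> (rot n ^^ Suc t) = (\<pi> \<circ> (rot n ^^ t)) \<circ> rot n"
        by (simp add: fun_eq_iff funpow_swap1)
      then show ?case
        using Suc perm_cycle_comp_rot permutes_compose[OF rot_permutes] by metis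
    qed (use \<pi> in simp)
    have "t < n \<Longrightarrow> (rot n ^^ Suc t) n = Suc t" for t
      by (induction t) (use assms in \<open>auto simp: rot_def\<close>)
    then have reach: "x \<in> {1..n} \<Longrightarrow> (rot n ^^ x) n = x" for x
      by (cases x) auto
    from assms(2) obtain x where "x \<in> {1..n}" "\<pi> x = w"
      using permutes_image[OF \<pi>] by (metis imageE)
    then show ?thesis
      using rot[of x] reach[of x] by (intro exI[of _ "\<pi> \<circ> (rot n ^^ x)"]) simp
  qed
  then have "perm_cycle n ` {\<pi>. \<pi> permutes {1..n}} \<subseteq> perm_cycle n ` {\<pi>. \<pi> permutes {1..n} \<and> \<pi> n = w}"
    by (smt (verit) image_iff image_subsetI mem_Collect_eq)
  then show ?thesis
    unfolding ham_cycles_eq[OF assms(1)] by blast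
qed

text \<open>All fibres of \<open>perm_cycle n\<close> over the rooted numberings have the same size:
  composing with \<open>\<sigma> \<circ> inv \<pi>\<close>, which fixes \<open>w\<close>, maps the
  fibre of \<open>\<pi>\<close> injectively into that of \<open>\<sigma>\<close>. For
  \<open>n \<ge> 3\<close> the common size \<open>M\<close> is two, one numbering for each direction
  of travel. One \<open>M\<close> serves all properties \<open>R\<close>, so ratios of counts of
  cycles can be computed with numberings.\<close>

lemma card_rooted_perms:
  assumes "n \<ge> 1" "w \<in> {1..n}"
  obtains M where "M > (0::nat)"
    and "\<And>R. card {\<pi>. \<pi> permutes {1..n} \<and> \<pi> n = w \<and> R (perm_cycle n \<pi>)} = M * card {C\<in>ham_cycles n. R C}"
proof -
  define RP where "RP = {\<pi>. \<pi> permutes {1..n} \<and> \<pi> n = w}"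
  have H: "ham_cycles n = perm_cycle n ` RP"
    unfolding RP_def by (rule ham_cycles_eq_rooted[OF assms])
  have fin: "finite RP"
    unfolding RP_def by (rule finite_subset[OF _ finite_permutations[of "{1..n}"]]) auto
  define F where "F C = {\<pi>\<in>RP. perm_cycle n \<pi> = C}" for C
  have le: "card (F (perm_cycle n \<pi>)) \<le> card (F (perm_cycle n \<sigma>))"
    if \<pi>: "\<pi> \<in> RP" and \<sigma>: "\<sigma> \<in> RP" for \<pi> \<sigma>
  proof (rule card_inj_on_le)
    let ?\<tau> = "\<sigma> \<circ> inv \<pi>"
    have \<tau>: "?\<tau> permutes {1..n}"
      using \<pi> \<sigma> by (auto simp: RP_def intro: permutes_compose permutes_inv)
    have "inv \<pi> w = n"
      using \<pi> by (auto simp: RP_def permutes_inverses)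
    then have \<tau>w: "?\<tau> w = w" using \<sigma> by (simp add: RP_def)
    have \<tau>\<pi>: "?\<tau> \<circ> \<pi> = \<sigma>"
      using \<pi> by (auto simp: RP_def fun_eq_iff permutes_inverses)
    show "inj_on ((\<circ>) ?\<tau>) (F (perm_cycle n \<pi>))"
      using permutes_inj[OF \<tau>] by (intro inj_onI) (metis fun.inj_map inj_eq)
    show "(\<circ>) ?\<tau> ` F (perm_cycle n \<pi>) \<subseteq> F (perm_cycle n \<sigma>)"
    proof
      fix \<rho> assume "\<rho> \<in> (\<circ>) ?\<tau> ` F (perm_cycle n \<pi>)"
      then obtain \<rho>' where \<rho>': "\<rho>' \<in> RP" "perm_cycle n \<rho>' = perm_cycle n \<pi>" "\<rho> = ?\<tau> \<circ> \<rho>'"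
        by (auto simp: F_def)
      have "\<rho> \<in> RP"
        using \<rho>' \<tau>w permutes_compose[OF _ \<tau>] by (auto simp: RP_def)
      moreover have "perm_cycle n \<rho> = perm_cycle n \<sigma>"
        using \<rho>' perm_cycle_comp \<tau>\<pi> by metis
      ultimately show "\<rho> \<in> F (perm_cycle n \<sigma>)" by (simp add: F_def)
    qed
    show "finite (F (perm_cycle n \<sigma>))" using fin by (simp add: F_def)
  qed
  from assms obtain \<pi>0 where \<pi>0: "\<pi>0 \<in> RP"
    using ham_cycles_eq[OF assms(1)] H permutes_id[of "{1..n}"] by (metis (mono_tags, lifting) empty_iff image_is_empty mem_Collect_eq ex_in_conv)
  show thesis
  proof
    show "card (F (perm_cycle n \<pi>0)) > 0"
      using \<pi>0 fin by (auto simp: F_def card_gt_0_iff)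
  next
    fix R
    have "{\<pi>. \<pi> permutes {1..n} \<and> \<pi> n = w \<and> R (perm_cycle n \<pi>)} = (\<Union>C\<in>{C\<in>ham_cycles n. R C}. F C)"
      by (auto simp: H F_def RP_def)
    also have "card \<dots> = (\<Sum>C\<in>{C\<in>ham_cycles n. R C}. card (F C))"
    proof (rule card_UN_disjoint)
      show "finite {C\<in>ham_cycles n. R C}"
        using finite_ham_cycles[OF assms(1)] by simp
      show "\<forall>C\<in>{C\<in>ham_cycles n. R C}. finite (F C)"
        using fin by (simp add: F_def)
      show "\<forall>C\<in>{C\<in>ham_cycles n. R C}. \<forall>D\<in>{C\<in>ham_cycles n. R C}. C \<noteq> D \<longrightarrow> F C \<inter> F D = {}"
        by (auto simp: F_def)
    qed
    also have "\<dots> = (\<Sum>C\<in>{C\<in>ham_cycles n. R C}. card (F (perm_cycle n \<pi>0)))"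
    proof (intro sum.cong refl)
      fix C assume "C \<in> {C\<in>ham_cycles n. R C}"
      then obtain \<pi> where "\<pi> \<in> RP" "C = perm_cycle n \<pi>" unfolding H by blast
      then show "card (F C) = card (F (perm_cycle n \<pi>0))"
        using le \<pi>0 by (simp add: antisym)
    qed
    finally show "card {\<pi>. \<pi> permutes {1..n} \<and> \<pi> n = w \<and> R (perm_cycle n \<pi>)}
        = card (F (perm_cycle n \<pi>0)) * card {C\<in>ham_cycles n. R C}"
      by (simp add: mult.commute)
  qed
qed

text \<open>Double counting of pairs of a numbering and a position: since \<open>G\<close> is closed
  under rotation, every position is hit equally often, namely as often as the closing position
  \<open>N\<close>.\<close>

lemma sum_card_perm_edge:
  assumes "finite G" and G: "\<And>\<pi>. \<pi> \<in> G \<Longrightarrow> \<pi> \<circ> rot N \<in> G"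
  shows "(\<Sum>\<pi>\<in>G. card {j\<in>{1..N}. Q (perm_edge N \<pi> j)}) = N * card {\<pi>\<in>G. Q (perm_edge N \<pi> N)}"
proof -
  define c where "c j = card {\<pi>\<in>G. Q (perm_edge N \<pi> j)}" for j
  have inj: "inj_on (\<lambda>\<pi>. \<pi> \<circ> rot N) G"
    using permutes_surj[OF rot_permutes] by (intro inj_onI) (metis surj_fun_eq)
  have surj: "(\<lambda>\<pi>. \<pi> \<circ> rot N) ` G = G"
    using assms inj by (intro endo_inj_surj) auto
  have rot: "c (rot N j) = c j" for j
    unfolding c_def
  proof (rule bij_betw_same_card)
    show "bij_betw (\<lambda>\<pi>. \<pi> \<circ> rot N) {\<pi>\<in>G. Q (perm_edge N \<pi> (rot N j))} {\<pi>\<in>G. Q (perm_edge N \<pi> j)}"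
      unfolding bij_betw_def
    proof
      show "inj_on (\<lambda>\<pi>. \<pi> \<circ> rot N) {\<pi>\<in>G. Q (perm_edge N \<pi> (rot N j))}"
        by (rule inj_on_subset[OF inj]) auto
      show "(\<lambda>\<pi>. \<pi> \<circ> rot N) ` {\<pi>\<in>G. Q (perm_edge N \<pi> (rot N j))} = {\<pi>\<in>G. Q (perm_edge N \<pi> j)}"
      proof (intro equalityI subsetI)
        fix \<rho> assume \<rho>: "\<rho> \<in> {\<pi>\<in>G. Q (perm_edge N \<pi> j)}"
        then obtain \<pi> where "\<pi> \<in> G" "\<rho> = \<pi> \<circ> rot N" using surj by blast
        with \<rho> show "\<rho> \<in> (\<lambda>\<pi>. \<pi> \<circ> rot N) ` {\<pi>\<in>G. Q (perm_edge N \<pi> (rot N j))}"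
          by (auto simp: perm_edge_comp_rot)
      qed (use G in \<open>auto simp: perm_edge_comp_rot\<close>)
    qed
  qed
  have const: "c j = c N" if "j \<le> N" "1 \<le> j" for j
    using that
  proof (induction j rule: inc_induct)
    case (step j)
    then have "rot N j = Suc j" by (simp add: rot_def)
    then show ?case using rot[of j] step by simp
  qed simp
  have "(\<Sum>\<pi>\<in>G. card {j\<in>{1..N}. Q (perm_edge N \<pi> j)}) = (\<Sum>j\<in>{1..N}. c j)"
    using assms(1) by (intro sum_multicount_gen) (auto simp: c_def)
  also have "\<dots> = (\<Sum>j\<in>{1..N}. c N)"
    by (intro sum.cong refl const) auto
  finally show ?thesis by (simp add: c_def)
qed

section \<open>Hamiltonian cycles through a matching and one further edge\<close>

lemma card_incident_matching:
  assumes "pairwise disjnt S"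
  shows "card {e\<in>S. v \<in> e} = (if v \<in> \<Union>S then 1 else 0)"
proof (cases "v \<in> \<Union>S")
  case True
  then obtain e where e: "e \<in> S" "v \<in> e" by blast
  then have "{e\<in>S. v \<in> e} = {e}"
    using assms by (auto simp: pairwise_def disjnt_iff)
  then show ?thesis using True by simp
next
  case False
  then have eq: "{e\<in>S. v \<in> e} = {}" by blast
  show ?thesis unfolding eq using False by simp
qed

text \<open>Removing the last vertex \<open>w\<close> replaces its two edges by the edge between its
  neighbours, and this is the closing edge of the cycle on the first \<open>n - 1\<close> positions.
  As \<open>n \<ge> 4\<close> leaves at least three positions, the closing edge differs from all
  other edges of the shortened cycle.\<close>

lemma perm_cycle_split:
  assumes "n \<ge> 4" "\<pi> permutes {1..n}" "\<pi> n = w"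
  defines "N \<equiv> n - 1"
  shows "perm_cycle n \<pi> = perm_edge N \<pi> ` {1..<N} \<union> {{\<pi> N, w}, {w, \<pi> 1}}"
    and "perm_cycle N \<pi> = perm_edge N \<pi> ` {1..<N} \<union> {perm_edge N \<pi> N}"
    and "perm_edge N \<pi> N = {\<pi> N, \<pi> 1}"
    and "perm_edge N \<pi> N \<notin> perm_edge N \<pi> ` {1..<N}"
    and "\<And>j. j \<in> {1..N} \<Longrightarrow> w \<notin> perm_edge N \<pi> j"
proof -
  have N: "N \<ge> 3" "n = Suc N" using assms by auto
  have inj: "inj \<pi>" using assms(2) by (rule permutes_inj)
  have "perm_edge n \<pi> j = perm_edge N \<pi> j" if "j \<in> {1..<N}" for j
    using that N by (simp add: perm_edge_def rot_def)
  moreover have "perm_edge n \<pi> N = {\<pi> N, w}" "perm_edge n \<pi> n = {w, \<pi> 1}"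
    using N assms(3) by (auto simp: perm_edge_def rot_def)
  moreover have "{1..n} = {1..<N} \<union> {N, n}" using N by auto
  ultimately show "perm_cycle n \<pi> = perm_edge N \<pi> ` {1..<N} \<union> {{\<pi> N, w}, {w, \<pi> 1}}"
    unfolding perm_cycle_def by (simp add: image_Un)
  have "{1..N} = {1..<N} \<union> {N}" using N by auto
  then show "perm_cycle N \<pi> = perm_edge N \<pi> ` {1..<N} \<union> {perm_edge N \<pi> N}"
    unfolding perm_cycle_def by (simp add: image_Un)
  show "perm_edge N \<pi> N = {\<pi> N, \<pi> 1}"
    using N by (simp add: perm_edge_def rot_def)
  show "perm_edge N \<pi> N \<notin> perm_edge N \<pi> ` {1..<N}"
  proof
    assume "perm_edge N \<pi> N \<in> perm_edge N \<pi> ` {1..<N}"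
    then obtain j where "j \<in> {1..<N}" "perm_edge N \<pi> N = perm_edge N \<pi> j" by blast
    then show False
      using inj_onD[OF inj_on_perm_edge[OF inj N(1)], of N j] N(1) by simp
  qed
  show "w \<notin> perm_edge N \<pi> j" if "j \<in> {1..N}" for j
  proof -
    have "rot N j \<in> {1..N}" using that permutes_in_image[OF rot_permutes] by blast
    then have "n \<noteq> j" "n \<noteq> rot N j" using that N(2) by auto
    then show ?thesis
      using inj by (auto simp: perm_edge_def inj_eq simp flip: assms(3))
  qed
qed

text \<open>Deleting an unmatched vertex \<open>w\<close> from a Hamiltonian cycle containing the matching \<open>S\<close> leaves
  a Hamiltonian cycle on the other vertices; conversely \<open>w\<close> can be reinserted into any of its
  \<open>n - 1 - card S\<close> edges outside \<open>S\<close>, of which one or two are incident with \<open>v\<close>.\<close>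

lemma card_ham_cycles_unmatched:
  assumes "n \<ge> 4" "S \<subseteq> edges n" "pairwise disjnt S"
    and w: "w \<in> {1..n}" "w \<notin> \<Union>S" and v: "v \<in> {1..n}" "v \<noteq> w"
  shows "(n - 1 - card S) * card {C\<in>ham_cycles n. S \<subseteq> C \<and> {w, v} \<in> C}
       = (if v \<in> \<Union>S then 1 else 2) * card {C\<in>ham_cycles n. S \<subseteq> C}"
proof -
  define N where "N = n - 1"
  have N: "N \<ge> 3" "n = Suc N" using assms(1) by (auto simp: N_def)
  \<comment> \<open>The numberings whose shortened cycle contains \<open>S\<close>. Rotating the
    first \<open>n - 1\<close> positions keeps that cycle and moves \<open>w\<close> to another
    place of insertion.\<close>
  define G where "G = {\<pi>. \<pi> permutes {1..n} \<and> \<pi> n = w \<and> S \<subseteq> perm_cycle N \<pi>}"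
  have finG: "finite G"
    unfolding G_def by (rule finite_subset[OF _ finite_permutations[of "{1..n}"]]) auto
  have closed: "\<pi> \<circ> rot N \<in> G" if "\<pi> \<in> G" for \<pi>
  proof -
    have "rot N permutes {1..n}"
      by (rule permutes_subset[OF rot_permutes]) (use N in auto)
    moreover have "rot N n = n" using N by (simp add: rot_def)
    ultimately show ?thesis
      using that by (auto simp: G_def perm_cycle_comp_rot intro: permutes_compose)
  qed
  \<comment> \<open>Inserting \<open>w\<close> destroys only the closing edge, which therefore has
    to lie outside \<open>S\<close>; the ends of the closing edge become the neighbours of
    \<open>w\<close>.\<close>
  have split: "S \<subseteq> perm_cycle n \<pi> \<longleftrightarrow> S \<subseteq> perm_cycle N \<pi> \<and> perm_edge N \<pi> N \<notin> S"
    "{w, v} \<in> perm_cycle n \<pi> \<longleftrightarrow> v \<in> perm_edge N \<pi> N"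
    if "\<pi> permutes {1..n}" "\<pi> n = w" for \<pi>
  proof -
    note sp = perm_cycle_split[OF assms(1) that, folded N_def]
    show "S \<subseteq> perm_cycle n \<pi> \<longleftrightarrow> S \<subseteq> perm_cycle N \<pi> \<and> perm_edge N \<pi> N \<notin> S"
      using sp(4) w(2) unfolding sp(1,2) by blast
    have "{w, v} \<notin> perm_edge N \<pi> ` {1..<N}"
      using sp(5) by fastforce
    then show "{w, v} \<in> perm_cycle n \<pi> \<longleftrightarrow> v \<in> perm_edge N \<pi> N"
      unfolding sp(1,3) using v(2) by (auto simp: doubleton_eq_iff)
  qed
  obtain M where M: "M > 0" "\<And>R. card {\<pi>. \<pi> permutes {1..n} \<and> \<pi> n = w \<and> R (perm_cycle n \<pi>)}
      = M * card {C\<in>ham_cycles n. R C}"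
    using card_rooted_perms[of n w] assms(1) w(1) by auto
  have 1: "M * card {C\<in>ham_cycles n. S \<subseteq> C} = card {\<pi>\<in>G. perm_edge N \<pi> N \<notin> S}"
    unfolding M(2)[symmetric] G_def using split by (intro arg_cong[where f = card]) blast
  have 2: "M * card {C\<in>ham_cycles n. S \<subseteq> C \<and> {w, v} \<in> C}
      = card {\<pi>\<in>G. perm_edge N \<pi> N \<notin> S \<and> v \<in> perm_edge N \<pi> N}"
    unfolding M(2)[symmetric] G_def using split by (intro arg_cong[where f = card]) blast
  \<comment> \<open>Of the two edges of the shortened cycle at \<open>v\<close>, one belongs to
    \<open>S\<close> if \<open>v\<close> is covered by \<open>S\<close>, and none otherwise.\<close>
  have cnt: "card {j\<in>{1..N}. perm_edge N \<pi> j \<notin> S} = N - card S"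
    "card {j\<in>{1..N}. perm_edge N \<pi> j \<notin> S \<and> v \<in> perm_edge N \<pi> j} = (if v \<in> \<Union>S then 1 else 2)"
    if "\<pi> \<in> G" for \<pi>
  proof -
    have \<pi>: "\<pi> permutes {1..n}" "\<pi> n = w" "S \<subseteq> perm_cycle N \<pi>" using that by (auto simp: G_def)
    note inj = permutes_inj[OF \<pi>(1)]
    have "{j\<in>{1..N}. perm_edge N \<pi> j \<notin> S} = {1..N} - {j\<in>{1..N}. perm_edge N \<pi> j \<in> S \<and> True}"
      by auto
    also have "card \<dots> = N - card {j\<in>{1..N}. perm_edge N \<pi> j \<in> S \<and> True}"
      by (subst card_Diff_subset) auto
    finally show "card {j\<in>{1..N}. perm_edge N \<pi> j \<notin> S} = N - card S"
      using card_perm_edge_in[OF inj N(1) \<pi>(3), of "\<lambda>_. True"] by simp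
    let ?A = "{j\<in>{1..N}. v \<in> perm_edge N \<pi> j}"
    let ?B = "{j\<in>{1..N}. perm_edge N \<pi> j \<in> S \<and> v \<in> perm_edge N \<pi> j}"
    have "{1..n} = insert n {1..N}" using N by auto
    then have "v \<in> \<pi> ` {1..N}"
      using v permutes_image[OF \<pi>(1)] \<pi>(2) by auto
    then have "card ?A = 2"
      using N by (intro card_perm_edge_incident[OF \<pi>(1)]) auto
    moreover have "card ?B = (if v \<in> \<Union>S then 1 else 0)"
      unfolding card_perm_edge_in[OF inj N(1) \<pi>(3)] by (rule card_incident_matching[OF assms(3)])
    moreover have "{j\<in>{1..N}. perm_edge N \<pi> j \<notin> S \<and> v \<in> perm_edge N \<pi> j} = ?A - ?B" by auto
    moreover have "card (?A - ?B) = card ?A - card ?B" by (rule card_Diff_subset) auto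
    ultimately show "card {j\<in>{1..N}. perm_edge N \<pi> j \<notin> S \<and> v \<in> perm_edge N \<pi> j}
        = (if v \<in> \<Union>S then 1 else 2)"
      by (auto split: if_splits)
  qed
  let ?A = "card {C\<in>ham_cycles n. S \<subseteq> C}"
    and ?B = "card {C\<in>ham_cycles n. S \<subseteq> C \<and> {w, v} \<in> C}"
    and ?s = "(if v \<in> \<Union>S then 1 else 2) :: nat"
  have A: "N * (M * ?A) = (N - card S) * card G"
  proof -
    have "N * (M * ?A) = (\<Sum>\<pi>\<in>G. card {j\<in>{1..N}. perm_edge N \<pi> j \<notin> S})"
      unfolding 1 using finG closed by (rule sum_card_perm_edge[symmetric])
    also have "\<dots> = (\<Sum>\<pi>\<in>G. N - card S)"
      by (intro sum.cong refl cnt(1))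
    finally show ?thesis by simp
  qed
  have B: "N * (M * ?B) = ?s * card G"
  proof -
    have "N * (M * ?B) = (\<Sum>\<pi>\<in>G. card {j\<in>{1..N}. perm_edge N \<pi> j \<notin> S \<and> v \<in> perm_edge N \<pi> j})"
      unfolding 2 using finG closed by (rule sum_card_perm_edge[symmetric])
    also have "\<dots> = (\<Sum>\<pi>\<in>G. ?s)"
      by (intro sum.cong refl cnt(2))
    finally show ?thesis by simp
  qed
  have "(N * M) * ((N - card S) * ?B) = (N - card S) * (N * (M * ?B))" by (simp only: ac_simps)
  also have "\<dots> = ?s * (N * (M * ?A))" unfolding A B by (simp only: ac_simps)
  also have "\<dots> = (N * M) * (?s * ?A)" by (simp only: ac_simps)
  finally show ?thesis
    using N M(1) unfolding N_def[symmetric] by (subst (asm) mult_cancel1) simp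
qed

lemma edge_cases:
  assumes "e \<in> edges n" "a \<in> e"
  obtains b where "e = {a, b}" "a \<noteq> b" "a \<in> {1..n}" "b \<in> {1..n}"
proof -
  obtain x y where "e = {x, y}" "x \<noteq> y" "e \<subseteq> {1..n}"
    using assms(1) by (auto simp: edges_def card_2_iff)
  with assms(2) that show ?thesis
    by (cases "a = x") (auto simp: insert_commute)
qed

lemma ham_cycle_degree:
  assumes "C \<in> ham_cycles n" "n \<ge> 3" "a \<in> {1..n}"
  shows "card {v\<in>{1..n} - {a}. {a, v} \<in> C} = 2"
proof -
  obtain \<pi> where \<pi>: "\<pi> permutes {1..n}" and C: "C = perm_cycle n \<pi>"
    using assms by (auto simp: ham_cycles_eq)
  have "card {e\<in>C. a \<in> e} = card {j\<in>{1..n}. perm_edge n \<pi> j \<in> C \<and> a \<in> perm_edge n \<pi> j}"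
    using card_perm_edge_in[OF permutes_inj[OF \<pi>] assms(2), of C "\<lambda>e. a \<in> e"] C by simp
  also have "{j\<in>{1..n}. perm_edge n \<pi> j \<in> C \<and> a \<in> perm_edge n \<pi> j} = {j\<in>{1..n}. a \<in> perm_edge n \<pi> j}"
    by (auto simp: C perm_cycle_def)
  also have "card \<dots> = 2"
    using assms permutes_image[OF \<pi>] by (intro card_perm_edge_incident[OF \<pi>]) auto
  finally have "card {e\<in>C. a \<in> e} = 2" .
  moreover have "bij_betw (\<lambda>v. {a, v}) {v\<in>{1..n} - {a}. {a, v} \<in> C} {e\<in>C. a \<in> e}"
    unfolding bij_betw_def
  proof
    show "inj_on (\<lambda>v. {a, v}) {v\<in>{1..n} - {a}. {a, v} \<in> C}"
      by (auto simp: inj_on_def doubleton_eq_iff)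
    show "(\<lambda>v. {a, v}) ` {v\<in>{1..n} - {a}. {a, v} \<in> C} = {e\<in>C. a \<in> e}"
    proof (intro equalityI subsetI)
      fix e assume "e \<in> {e\<in>C. a \<in> e}"
      then have e: "e \<in> C" "e \<in> edges n" "a \<in> e"
        using ham_cycles_subset_edges[OF assms(1)] assms(2) by auto
      from e(2,3) obtain b where "e = {a, b}" "a \<noteq> b" "b \<in> {1..n}"
        by (rule edge_cases)
      then show "e \<in> (\<lambda>v. {a, v}) ` {v\<in>{1..n} - {a}. {a, v} \<in> C}"
        using e(1) by auto
    qed auto
  qed
  ultimately show ?thesis by (simp add: bij_betw_same_card)
qed

text \<open>Relabelling by \<open>\<tau>\<close> is injective on cycles, and it carries the first
  family into the second. An inequality is enough, because the reverse one follows by exchanging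
  \<open>x\<close> and \<open>y\<close>.\<close>

lemma card_ham_cycles_permute_le:
  assumes "n \<ge> 1" "\<tau> permutes {1..n}" "finite S" "(`) \<tau> ` S \<subseteq> S" "\<tau> a = a" "\<tau> x = y"
  shows "card {C\<in>ham_cycles n. S \<subseteq> C \<and> {a, x} \<in> C} \<le> card {C\<in>ham_cycles n. S \<subseteq> C \<and> {a, y} \<in> C}"
proof (rule card_inj_on_le)
  have inj: "inj \<tau>" using assms(2) by (rule permutes_inj)
  have inj2: "inj ((`) \<tau>)"
    by (rule injI) (simp only: inj_image_eq_iff[OF inj])
  show "inj_on ((`) ((`) \<tau>)) {C\<in>ham_cycles n. S \<subseteq> C \<and> {a, x} \<in> C}"
    by (rule inj_onI) (simp only: inj_image_eq_iff[OF inj2])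
  have S: "(`) \<tau> ` S = S"
    by (rule endo_inj_surj[OF assms(3,4) inj_on_subset[OF inj2 subset_UNIV]])
  show "(`) ((`) \<tau>) ` {C\<in>ham_cycles n. S \<subseteq> C \<and> {a, x} \<in> C} \<subseteq> {C\<in>ham_cycles n. S \<subseteq> C \<and> {a, y} \<in> C}"
  proof (rule image_subsetI)
    fix C assume C: "C \<in> {C\<in>ham_cycles n. S \<subseteq> C \<and> {a, x} \<in> C}"
    then have C': "C \<in> ham_cycles n" "S \<subseteq> C" "{a, x} \<in> C" by simp_all
    have "(`) \<tau> ` S \<subseteq> (`) \<tau> ` C" using C'(2) by (rule image_mono)
    moreover have "\<tau> ` {a, x} \<in> (`) \<tau> ` C" using C'(3) by (rule imageI)
    moreover have "\<tau> ` {a, x} = {a, y}" using assms(5,6) by simp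
    moreover have "(`) \<tau> ` C \<in> ham_cycles n" by (rule ham_cycles_image[OF C'(1) assms(2,1)])
    ultimately show "(`) \<tau> ` C \<in> {C\<in>ham_cycles n. S \<subseteq> C \<and> {a, y} \<in> C}"
      unfolding S by simp
  qed
  show "finite {C\<in>ham_cycles n. S \<subseteq> C \<and> {a, y} \<in> C}"
    using finite_ham_cycles[OF assms(1)] by simp
qed

text \<open>A symmetry of the matching that fixes \<open>a\<close> takes \<open>x\<close> to
  \<open>y\<close>: the transposition of \<open>x\<close> and \<open>y\<close> if they are matched
  to each other, and otherwise the exchange of their two matching edges.\<close>

lemma card_ham_cycles_matched_le:
  assumes "n \<ge> 1" "S \<subseteq> edges n" "pairwise disjnt S" "{a, b} \<in> S"
    and x: "x \<in> \<Union>S - {a, b}" and y: "y \<in> \<Union>S - {a, b}"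
  shows "card {C\<in>ham_cycles n. S \<subseteq> C \<and> {a, x} \<in> C} \<le> card {C\<in>ham_cycles n. S \<subseteq> C \<and> {a, y} \<in> C}"
proof -
  have finS: "finite S" using assms(2) finite_edges finite_subset by blast
  have partner: "\<exists>z'. {z, z'} \<in> S \<and> z \<noteq> z' \<and> z \<in> {1..n} \<and> z' \<in> {1..n} \<and> a \<noteq> z \<and> a \<noteq> z'"
    if z: "z \<in> \<Union>S - {a, b}" for z
  proof -
    from z obtain e where e: "e \<in> S" "z \<in> e" by blast
    then have "e \<in> edges n" using assms(2) by blast
    then obtain z' where z': "e = {z, z'}" "z \<noteq> z'" "z \<in> {1..n}" "z' \<in> {1..n}"
      using e(2) by (rule edge_cases)
    have "e \<noteq> {a, b}" using e z by blast
    then have "disjnt e {a, b}" by (rule pairwiseD[OF assms(3) e(1) assms(4)])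
    then have "a \<noteq> z" "a \<noteq> z'" using z'(1) by (auto simp: disjnt_iff)
    then show ?thesis using e(1) z' by blast
  qed
  obtain x' where x': "{x, x'} \<in> S" "x \<noteq> x'" "x \<in> {1..n}" "x' \<in> {1..n}" "a \<noteq> x" "a \<noteq> x'"
    using partner[OF x] by blast
  obtain y' where y': "{y, y'} \<in> S" "y \<noteq> y'" "y \<in> {1..n}" "y' \<in> {1..n}" "a \<noteq> y" "a \<noteq> y'"
    using partner[OF y] by blast
  have disj: "e \<inter> f = {}" if "e \<in> S" "f \<in> S" "e \<noteq> f" for e f
    using that assms(3) by (auto simp: pairwise_def disjnt_def)
  consider "x = y" | "x \<noteq> y" "x' = y" | "x \<noteq> y" "x' \<noteq> y" by blast
  then show ?thesis
  proof cases
    case 1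
    then show ?thesis by simp
  next
    case 2
    let ?\<tau> = "transpose x y"
    have "?\<tau> permutes {1..n}" using x' y' by (intro permutes_swap_id)
    moreover have "?\<tau> ` e \<in> S" if e: "e \<in> S" for e
    proof (cases "e = {x, y}")
      case True
      then have "?\<tau> ` e = {x, y}" by (simp add: insert_commute)
      then show ?thesis using e True by simp
    next
      case False
      then have "e \<inter> {x, y} = {}" using disj[OF e x'(1)] 2 by simp
      then have "?\<tau> ` e = e"
        by (intro transpose_image_eq) simp
      then show ?thesis using e by simp
    qed
    then have "(`) ?\<tau> ` S \<subseteq> S" by blast
    moreover have "?\<tau> a = a" using x' y' by (simp add: transpose_def)
    ultimately show ?thesis
      using assms(1) finS by (intro card_ham_cycles_permute_le[where \<tau> = ?\<tau>]) simp_all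
  next
    case 3
    then have "{x, x'} \<noteq> {y, y'}" by (simp add: doubleton_eq_iff)
    then have xy: "{x, x'} \<inter> {y, y'} = {}" using disj x'(1) y'(1) by blast
    then have ne: "x \<noteq> y" "x \<noteq> y'" "x' \<noteq> y" "x' \<noteq> y'" by simp_all
    let ?\<tau> = "transpose x y \<circ> transpose x' y'"
    have "?\<tau> permutes {1..n}"
      using x' y' by (intro permutes_compose permutes_swap_id)
    moreover have "?\<tau> ` e \<in> S" if e: "e \<in> S" for e
    proof -
      consider "e = {x, x'}" | "e = {y, y'}" | "e \<inter> {x, x'} = {}" "e \<inter> {y, y'} = {}"
        using disj[OF e x'(1)] disj[OF e y'(1)] by blast
      then show ?thesis
      proof cases
        case 1
        have "?\<tau> ` {x, x'} = {y, y'}" using ne x'(2) y'(2) by (auto simp: transpose_def)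
        then show ?thesis using y'(1) 1 by simp
      next
        case 2
        have "?\<tau> ` {y, y'} = {x, x'}" using ne x'(2) y'(2) by (auto simp: transpose_def)
        then show ?thesis using x'(1) 2 by simp
      next
        case 3
        then have "?\<tau> z = z" if "z \<in> e" for z
          using that by (auto simp: transpose_def)
        then have "?\<tau> ` e = id ` e" by (intro image_cong refl) simp
        then show ?thesis using e by simp
      qed
    qed
    then have "(`) ?\<tau> ` S \<subseteq> S" by blast
    moreover have "?\<tau> a = a" using x' y' by (simp add: transpose_def)
    moreover have "?\<tau> x = y" using ne x'(2) y'(2) by (simp add: transpose_def)
    ultimately show ?thesis
      using assms(1) finS by (intro card_ham_cycles_permute_le[where \<tau> = ?\<tau>]) simp_all
  qed
qed

text \<open>Each cycle through \<open>S\<close> is counted once for each of its two edges at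
  \<open>a\<close>.\<close>

lemma sum_card_ham_cycles_degree:
  assumes "n \<ge> 3" "a \<in> {1..n}"
  shows "(\<Sum>v\<in>{1..n} - {a}. card {C\<in>ham_cycles n. S \<subseteq> C \<and> {a, v} \<in> C}) = 2 * card {C\<in>ham_cycles n. S \<subseteq> C}"
proof -
  have "(\<Sum>v\<in>{1..n} - {a}. card {C\<in>{C\<in>ham_cycles n. S \<subseteq> C}. {a, v} \<in> C}) = (\<Sum>C\<in>{C\<in>ham_cycles n. S \<subseteq> C}. 2)"
  proof (rule sum_multicount_gen)
    show "finite ({1..n} - {a})" "finite {C\<in>ham_cycles n. S \<subseteq> C}"
      using assms finite_ham_cycles by simp_all
    show "\<forall>C\<in>{C\<in>ham_cycles n. S \<subseteq> C}. card {v\<in>{1..n} - {a}. {a, v} \<in> C} = 2"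
      using ham_cycle_degree[OF _ assms] by blast
  qed
  moreover have "{C\<in>{C\<in>ham_cycles n. S \<subseteq> C}. {a, v} \<in> C} = {C\<in>ham_cycles n. S \<subseteq> C \<and> {a, v} \<in> C}" for v
    by blast
  ultimately show ?thesis by simp
qed

lemma card_Union_matching:
  assumes "S \<subseteq> edges n" "pairwise disjnt S"
  shows "card (\<Union>S) = 2 * card S" "\<Union>S \<subseteq> {1..n}"
proof -
  have e: "finite e \<and> card e = 2" if "e \<in> S" for e
    using that assms(1) by (auto simp: edges_def card_2_iff)
  have "card (\<Union>S) = sum card S"
    using assms(2) e by (intro card_Union_disjoint) auto
  also have "\<dots> = (\<Sum>e\<in>S. 2)"
    using e by (intro sum.cong) auto
  finally show "card (\<Union>S) = 2 * card S" by simp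
  show "\<Union>S \<subseteq> {1..n}" using assms(1) by (auto simp: edges_def)
qed

text \<open>Both ends are covered, so neither can be deleted and reinserted. The count is instead
  solved from the degree equation at \<open>a\<close>: the partner \<open>b\<close> of
  \<open>a\<close> contributes all cycles through \<open>S\<close>, the uncovered vertices
  contribute what the deletion argument gives, and the \<open>2 * k - 2\<close> remaining covered
  vertices contribute equally by symmetry.\<close>

lemma card_ham_cycles_matched:
  assumes "n \<ge> 4" "S \<subseteq> edges n" "pairwise disjnt S"
    and ac: "a \<in> \<Union>S" "c \<in> \<Union>S" "a \<noteq> c" "{a, c} \<notin> S"
  shows "2 * (n - 1 - card S) * card {C\<in>ham_cycles n. S \<subseteq> C \<and> {a, c} \<in> C} = card {C\<in>ham_cycles n. S \<subseteq> C}"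
proof -
  define f where "f v = card {C\<in>ham_cycles n. S \<subseteq> C \<and> {a, v} \<in> C}" for v
  define k where "k = card S"
  define N where "N = card {C\<in>ham_cycles n. S \<subseteq> C}"
  note U = card_Union_matching[OF assms(2,3)]
  have finU: "finite (\<Union>S)" using U(2) finite_subset by blast
  have "finite S" using assms(2) finite_edges finite_subset by blast
  obtain b where b: "{a, b} \<in> S" "a \<noteq> b" "a \<in> {1..n}" "b \<in> {1..n}"
  proof -
    from ac(1) obtain e where e: "e \<in> S" "a \<in> e" by blast
    then have "e \<in> edges n" using assms(2) by blast
    from this e(2) obtain b where "e = {a, b}" "a \<noteq> b" "a \<in> {1..n}" "b \<in> {1..n}" by (rule edge_cases)
    then show thesis using e(1) that by blast
  qed
  have cb: "c \<noteq> b" using ac b by blast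
  obtain e where e: "e \<in> S" "c \<in> e" using ac(2) by blast
  have "e \<noteq> {a, b}" using cb ac e(2) by blast
  then have "card {e, {a, b}} \<le> card S"
    using e(1) b(1) \<open>finite S\<close> by (intro card_mono) simp_all
  then have k2: "2 \<le> k" using \<open>e \<noteq> {a, b}\<close> by (simp add: k_def)
  have "2 * k \<le> n" using card_mono[OF _ U(2)] U(1) by (simp add: k_def)
  have fb: "f b = N"
    unfolding f_def N_def using b(1) by (intro arg_cong[where f = card]) blast
  have free: "(n - 1 - k) * f v = N" if v: "v \<in> {1..n} - \<Union>S" for v
  proof -
    have "a \<noteq> v" using v ac by blast
    then have "(n - 1 - k) * card {C\<in>ham_cycles n. S \<subseteq> C \<and> {v, a} \<in> C} = N"
      unfolding k_def N_def
      using card_ham_cycles_unmatched[OF assms(1-3), of v a] v b(3) ac(1) by simp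
    then show ?thesis by (simp add: f_def insert_commute)
  qed
  have sat: "f v = f c" if "v \<in> \<Union>S - {a, b}" for v
    using that ac cb card_ham_cycles_matched_le[OF _ assms(2,3) b(1)] assms(1)
    unfolding f_def by (intro antisym) simp_all
  let ?V = "{1..n} - \<Union>S" and ?W = "\<Union>S - {a, b}"
  have "{1..n} - {a} = insert b (?V \<union> ?W)" using U(2) b ac by blast
  then have "2 * N = f b + (sum f ?V + sum f ?W)"
  proof -
    have "2 * N = sum f ({1..n} - {a})"
      using sum_card_ham_cycles_degree[of n a S] assms(1) b(3) by (simp add: f_def N_def)
    also have "\<dots> = sum f (insert b (?V \<union> ?W))"
      using \<open>{1..n} - {a} = insert b (?V \<union> ?W)\<close> by simp
    also have "\<dots> = f b + sum f (?V \<union> ?W)"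
      using finU b(1) by (intro sum.insert) auto
    also have "sum f (?V \<union> ?W) = sum f ?V + sum f ?W"
      using finU by (intro sum.union_disjoint) auto
    finally show ?thesis .
  qed
  moreover have "sum f ?W = (2 * k - 2) * f c"
  proof -
    have "card ?W = 2 * k - 2"
      using U(1) b ac by (subst card_Diff_subset) (auto simp: k_def)
    then show ?thesis using sat by simp
  qed
  moreover have "(n - 1 - k) * sum f ?V = (n - 2 * k) * N"
  proof -
    have "card ?V = n - 2 * k"
      using U finU by (subst card_Diff_subset) (auto simp: k_def)
    then show ?thesis using free by (simp add: sum_distrib_left)
  qed
  ultimately have "(n - 1 - k) * (2 * N) = (n - 1 - k) * N + (n - 2 * k) * N + (n - 1 - k) * ((2 * k - 2) * f c)"
    by (simp add: fb distrib_left)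
  \<comment> \<open>This substitution removes the truncated subtractions: \<open>n - 1 - k\<close>
    is \<open>j + 1 + d\<close> and \<open>n - 2 * k\<close> is \<open>d\<close>. In the degree
    equation all terms but a multiple of \<open>j + 1\<close> cancel.\<close>
  moreover obtain j d where "k = j + 2" "n = 2 * k + d"
    using k2 \<open>2 * k \<le> n\<close> by (metis le_Suc_ex add.commute)
  ultimately have "(j + 1) * N = (j + 1) * (2 * (n - 1 - k) * f c)"
    by (simp add: algebra_simps)
  then show ?thesis
    unfolding mult_cancel1 by (simp add: f_def N_def k_def)
qed

text \<open>The expected value of the coordinate \<open>e\<close> on a random Hamiltonian cycle containing the
  matching \<open>S\<close>, multiplied by \<open>2 * (n - 1 - card S)\<close>.\<close>

definition matching_weight :: "nat \<Rightarrow> nat set set \<Rightarrow> nat set \<Rightarrow> real" where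
  "matching_weight n S e = (if e \<in> S then 2 * (real n - 1 - real (card S))
     else (\<Prod>v\<in>e. if v \<in> \<Union>S then 1 else 2))"

text \<open>For \<open>e\<close> outside \<open>S\<close>, an uncovered end, if there is one, serves
  as the deleted vertex and accounts for a factor \<open>2\<close>; if both ends are covered, the
  degree argument applies.\<close>

lemma card_ham_cycles_matching_edge:
  assumes "n \<ge> 4" "S \<subseteq> edges n" "pairwise disjnt S" "e \<in> edges n"
  shows "2 * (real n - 1 - real (card S)) * real (card {C\<in>ham_cycles n. S \<subseteq> C \<and> e \<in> C})
       = matching_weight n S e * real (card {C\<in>ham_cycles n. S \<subseteq> C})"
proof (cases "e \<in> S")
  case True
  then have "{C\<in>ham_cycles n. S \<subseteq> C \<and> e \<in> C} = {C\<in>ham_cycles n. S \<subseteq> C}" by blast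
  then show ?thesis using True by (simp add: matching_weight_def)
next
  case False
  obtain u v where e: "e = {u, v}" "u \<noteq> v" "u \<in> {1..n}" "v \<in> {1..n}"
    using assms(4) by (auto simp: edges_def card_2_iff)
  have "2 * card S \<le> n"
    using card_Union_matching[OF assms(2,3)] card_mono[of "{1..n}" "\<Union>S"] by simp
  then have k: "real n - 1 - real (card S) = real (n - 1 - card S)"
    using assms(1) by (simp add: of_nat_diff)
  have "2 * (n - 1 - card S) * card {C\<in>ham_cycles n. S \<subseteq> C \<and> e \<in> C}
      = (if u \<in> \<Union>S then 1 else 2) * (if v \<in> \<Union>S then 1 else 2) * card {C\<in>ham_cycles n. S \<subseteq> C}"
  proof -
    consider "u \<notin> \<Union>S" | "v \<notin> \<Union>S" "u \<in> \<Union>S" | "u \<in> \<Union>S" "v \<in> \<Union>S" by blast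
    then show ?thesis
    proof cases
      case 1
      then show ?thesis
        using card_ham_cycles_unmatched[OF assms(1-3), of u v] e by (simp only: e(1) if_False mult.assoc) simp
    next
      case 2
      then show ?thesis
        using card_ham_cycles_unmatched[OF assms(1-3), of v u] e
        by (simp only: e(1) insert_commute[of u] if_False if_True mult.assoc) simp
    next
      case 3
      then show ?thesis
        using card_ham_cycles_matched[OF assms(1-3), of u v] e False by (simp only: if_True) simp
    qed
  qed
  then have "real (2 * (n - 1 - card S) * card {C\<in>ham_cycles n. S \<subseteq> C \<and> e \<in> C})
      = real ((if u \<in> \<Union>S then 1 else 2) * (if v \<in> \<Union>S then 1 else 2) * card {C\<in>ham_cycles n. S \<subseteq> C})"
    by (rule arg_cong)
  moreover have "matching_weight n S e = real ((if u \<in> \<Union>S then 1 else 2) * (if v \<in> \<Union>S then 1 else 2))"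
    using False e(2) by (simp add: matching_weight_def e(1))
  ultimately show ?thesis
    unfolding k by simp
qed

text \<open>Linearity of expectation over the edges, with denominators cleared.\<close>

lemma sum_ham_cycles_matching:
  assumes "n \<ge> 4" "S \<subseteq> edges n" "pairwise disjnt S"
  shows "2 * (real n - 1 - real (card S)) * (\<Sum>C\<in>{C\<in>ham_cycles n. S \<subseteq> C}. \<Sum>e\<in>C. c e)
       = real (card {C\<in>ham_cycles n. S \<subseteq> C}) * (\<Sum>e\<in>edges n. c e * matching_weight n S e)"
proof -
  let ?H = "{C\<in>ham_cycles n. S \<subseteq> C}" and ?d = "2 * (real n - 1 - real (card S))"
  have fin: "finite ?H" using finite_ham_cycles assms(1) by simp
  have "(\<Sum>C\<in>?H. \<Sum>e\<in>C. c e) = (\<Sum>C\<in>?H. \<Sum>e\<in>{e\<in>edges n. e \<in> C}. c e)"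
    using ham_cycles_subset_edges assms(1) by (intro sum.cong refl) force
  also have "\<dots> = (\<Sum>e\<in>edges n. \<Sum>C\<in>{C\<in>?H. e \<in> C}. c e)"
    by (rule sum.swap_restrict[OF fin finite_edges])
  also have "\<dots> = (\<Sum>e\<in>edges n. c e * real (card {C\<in>ham_cycles n. S \<subseteq> C \<and> e \<in> C}))"
    by (intro sum.cong refl) (simp add: conj_assoc)
  finally have "?d * (\<Sum>C\<in>?H. \<Sum>e\<in>C. c e)
      = (\<Sum>e\<in>edges n. c e * (?d * real (card {C\<in>ham_cycles n. S \<subseteq> C \<and> e \<in> C})))"
    by (simp add: sum_distrib_left mult.left_commute)
  also have "\<dots> = (\<Sum>e\<in>edges n. c e * (matching_weight n S e * real (card ?H)))"
    by (intro sum.cong refl) (simp only: card_ham_cycles_matching_edge[OF assms])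
  also have "\<dots> = real (card ?H) * (\<Sum>e\<in>edges n. c e * matching_weight n S e)"
    unfolding sum_distrib_left by (intro sum.cong refl) simp
  finally show ?thesis .
qed

section \<open>Averaging over the matchings inside a fixed Hamiltonian cycle\<close>

text \<open>Each factor is \<open>1\<close> plus the indicator that \<open>K\<close> avoids an
  index; after expansion, only sets avoiding given indices have to be counted. The index
  \<open>m\<close> is avoided by every \<open>K\<close>, which explains the correction term; it
  stands for the vertex left over by a near-perfect matching.\<close>

lemma sum_subsets_avoiding:
  fixes m k i j :: nat
  defines "Ks \<equiv> {K. K \<subseteq> {..<m} \<and> card K = k}"
  assumes "i \<noteq> j" "i \<le> m" "j \<le> m"
  shows "(\<Sum>K\<in>Ks. (if i \<in> K then 1 else 2) * (if j \<in> K then 1 else 2 :: real))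
       = real (m choose k) + 2 * real ((m - 1) choose k) + real ((m - 2) choose k)
         + (of_bool (i = m) + of_bool (j = m)) * (real (m choose k) - real ((m - 2) choose k))"
proof -
  have fin: "finite Ks" by (simp add: Ks_def)
  have avoid: "card {K\<in>Ks. K \<inter> A = {}} = card ({..<m} - A) choose k" for A
  proof -
    have "{K\<in>Ks. K \<inter> A = {}} = {K. K \<subseteq> {..<m} - A \<and> card K = k}"
      by (auto simp: Ks_def)
    then show ?thesis by (simp add: n_subsets)
  qed
  have "(\<Sum>K\<in>Ks. (if i \<in> K then 1 else 2) * (if j \<in> K then 1 else 2 :: real))
      = (\<Sum>K\<in>Ks. 1 + of_bool (K \<inter> {i} = {}) + of_bool (K \<inter> {j} = {}) + of_bool (K \<inter> {i, j} = {}))"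
    by (intro sum.cong) auto
  also have "\<dots> = real (card {K\<in>Ks. K \<inter> {} = {}}) + real (card {K\<in>Ks. K \<inter> {i} = {}})
      + real (card {K\<in>Ks. K \<inter> {j} = {}}) + real (card {K\<in>Ks. K \<inter> {i, j} = {}})"
    using fin by (simp add: sum.distrib Int_def)
  also have "\<dots> = real (m choose k) + real (card ({..<m} - {i}) choose k)
      + real (card ({..<m} - {j}) choose k) + real (card ({..<m} - {i, j}) choose k)"
    by (simp only: avoid) simp
  also have "\<dots> = real (m choose k) + 2 * real ((m - 1) choose k) + real ((m - 2) choose k)
      + (of_bool (i = m) + of_bool (j = m)) * (real (m choose k) - real ((m - 2) choose k))"
  proof -
    consider "i < m" "j < m" | "i = m" "j < m" | "i < m" "j = m" using assms by linarith
    then show ?thesis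
    proof cases
      case 1
      then have "card ({..<m} - {i, j}) = m - 2"
        using \<open>i \<noteq> j\<close> by (subst card_Diff_subset) auto
      then show ?thesis using 1 by simp
    next
      case 2
      then have "{..<m} - {i} = {..<m}" "{..<m} - {i, j} = {..<m} - {j}" by auto
      then show ?thesis using 2 by simp
    next
      case 3
      then have "{..<m} - {j} = {..<m}" "{..<m} - {i, j} = {..<m} - {i}" by auto
      then show ?thesis using 3 by simp
    qed
  qed
  finally show ?thesis .
qed

text \<open>This is \<open>matching_weight\<close> in terms of positions: block \<open>i\<close>
  consists of the positions \<open>2 * i\<close> and \<open>2 * i + 1\<close>, and \<open>K\<close>
  holds the blocks chosen as matching edges. For odd \<open>n\<close> the last position is alone in
  block \<open>n div 2\<close>.\<close>

definition block_weight :: "nat \<Rightarrow> nat set \<Rightarrow> nat \<Rightarrow> nat \<Rightarrow> real" where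
  "block_weight n K a b = (if a div 2 = b div 2 \<and> a div 2 \<in> K then 2 * (real n - 1 - real (card K))
     else (if a div 2 \<in> K then 1 else 2) * (if b div 2 \<in> K then 1 else 2))"

lemma block_matching:
  assumes q: "bij_betw q {..<n} {1..n}" and K: "K \<subseteq> {..<n div 2}"
  defines "S \<equiv> (\<lambda>i. {q (2 * i), q (2 * i + 1)}) ` K"
  shows "pairwise disjnt S" "card S = card K"
    and "\<And>a b. a < n \<Longrightarrow> b < n \<Longrightarrow> a \<noteq> b \<Longrightarrow> matching_weight n S {q a, q b} = block_weight n K a b"
proof -
  have q_eq: "q a = q b \<longleftrightarrow> a = b" if "a < n" "b < n" for a b
    using that bij_betw_imp_inj_on[OF q] by (simp add: inj_on_eq_iff)
  have lt: "2 * i < n" "2 * i + 1 < n" if "i \<in> K" for i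
    using that K by auto
  have mem: "q a \<in> {q (2 * i), q (2 * i + 1)} \<longleftrightarrow> a div 2 = i" if "a < n" "i \<in> K" for a i
  proof -
    have "q a \<in> {q (2 * i), q (2 * i + 1)} \<longleftrightarrow> a = 2 * i \<or> a = 2 * i + 1"
      using q_eq[OF that(1) lt(1)[OF that(2)]] q_eq[OF that(1) lt(2)[OF that(2)]] by simp
    then show ?thesis by presburger
  qed
  have disj: "{q (2 * i), q (2 * i + 1)} \<inter> {q (2 * j), q (2 * j + 1)} = {}" if "i \<in> K" "j \<in> K" "i \<noteq> j" for i j
    using mem[OF lt(1)[OF that(1)] that(2)] mem[OF lt(2)[OF that(1)] that(2)] that(3) by simp
  then show "pairwise disjnt S"
    by (auto simp: S_def pairwise_def disjnt_def)
  have "inj_on (\<lambda>i. {q (2 * i), q (2 * i + 1)}) K"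
    using disj by (intro inj_onI) blast
  then show card: "card S = card K"
    unfolding S_def by (rule card_image)
  have sat: "q a \<in> \<Union>S \<longleftrightarrow> a div 2 \<in> K" if "a < n" for a
    using mem[OF that] unfolding S_def by blast
  fix a b assume ab: "a < n" "b < n" "a \<noteq> b"
  have edge: "{q a, q b} \<in> S \<longleftrightarrow> a div 2 = b div 2 \<and> a div 2 \<in> K"
  proof
    assume "{q a, q b} \<in> S"
    then obtain i where "i \<in> K" "{q a, q b} = {q (2 * i), q (2 * i + 1)}" by (auto simp: S_def)
    then show "a div 2 = b div 2 \<and> a div 2 \<in> K"
      using mem[OF ab(1)] mem[OF ab(2)] by blast
  next
    assume h: "a div 2 = b div 2 \<and> a div 2 \<in> K"
    obtain i where i: "i = a div 2" by blast
    then have "(a = 2 * i \<and> b = 2 * i + 1) \<or> (b = 2 * i \<and> a = 2 * i + 1)"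
      using conjunct1[OF h] ab(3) by presburger
    then have "{q a, q b} = {q (2 * i), q (2 * i + 1)}"
      by (elim disjE) (simp_all add: insert_commute)
    then show "{q a, q b} \<in> S" using conjunct2[OF h] unfolding S_def i by (rule image_eqI)
  qed
  have "q a \<noteq> q b" using q_eq ab by simp
  then have "(\<Prod>v\<in>{q a, q b}. if v \<in> \<Union>S then 1 else 2 :: real)
      = (if q a \<in> \<Union>S then 1 else 2) * (if q b \<in> \<Union>S then 1 else 2)"
    by (subst prod.insert) auto
  then show "matching_weight n S {q a, q b} = block_weight n K a b"
    unfolding matching_weight_def block_weight_def edge card sat[OF ab(1)] sat[OF ab(2)]
    by (rule arg_cong)
qed

text \<open>For \<open>x\<close> and \<open>r\<close> below \<open>n\<close> this is
  \<open>x - r\<close> modulo \<open>n\<close>: the position of \<open>x\<close> when counting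
  starts at \<open>r\<close>.\<close>

definition offset :: "nat \<Rightarrow> nat \<Rightarrow> nat \<Rightarrow> nat" where
  "offset n x r = (if r \<le> x then x - r else x + n - r)"

lemma offset_simps:
  assumes "x < n" "r < n"
  shows "offset n x r < n" "(r + offset n x r) mod n = x" "offset n ((r + x) mod n) r = x"
    and "offset n x (offset n x r) = r"
    and "offset n (Suc x mod n) r = Suc (offset n x r) mod n"
proof -
  show "offset n x r < n" "(r + offset n x r) mod n = x" "offset n x (offset n x r) = r"
    using assms by (auto simp: offset_def)
  show "offset n ((r + x) mod n) r = x"
    using assms by (cases "r + x < n") (auto simp: offset_def mod_if)
  show "offset n (Suc x mod n) r = Suc (offset n x r) mod n"
    using assms by (cases "Suc x = n"; cases "r = Suc x"; cases "r = 0") (auto simp: offset_def mod_if)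
qed

text \<open>For fixed \<open>x\<close>, sending the starting point to the position of
  \<open>x\<close> is an involution of \<open>{..<n}\<close>, so \<open>x\<close> takes every
  position exactly once.\<close>

lemma sum_offset:
  assumes "x < n"
  shows "(\<Sum>r<n. g (offset n x r)) = (\<Sum>a<n. g a)"
  using assms by (intro sum.reindex_bij_witness[where i = "offset n x" and j = "offset n x"]) (auto simp: offset_simps)

text \<open>The sum of \<open>sum_subsets_avoiding\<close> over all \<open>n\<close> starting
  points. In the last term \<open>n - 2 * m\<close> is the parity of \<open>n\<close>, and the
  factor \<open>2\<close> stands for the two ends of the chord, each of which is left over once when
  \<open>n\<close> is odd.\<close>

definition chord_weight :: "nat \<Rightarrow> nat \<Rightarrow> real" where
  "chord_weight n k = (let m = n div 2 in
     real n * (real (m choose k) + 2 * real ((m - 1) choose k) + real ((m - 2) choose k))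
     + 2 * (real n - 2 * real m) * (real (m choose k) - real ((m - 2) choose k)))"

text \<open>Number the vertices along \<open>C0\<close> and, for each starting point \<open>r\<close>, take the \<open>k\<close>-subsets of the
  (near-)perfect matching formed by every other edge of \<open>C0\<close> from \<open>r\<close> on. Two vertices that are not
  adjacent in \<open>C0\<close> always lie in different edges of this matching, so that all chords get the
  same total weight.\<close>

lemma matchings_of_ham_cycle:
  assumes "n \<ge> 4" "C0 \<in> ham_cycles n"
  obtains I :: "(nat \<times> nat set) set" and S \<gamma> where
    "finite I" "card I = n * ((n div 2) choose k)"
    "\<And>i. i \<in> I \<Longrightarrow> S i \<subseteq> C0 \<and> pairwise disjnt (S i) \<and> card (S i) = k"
    "\<And>e. e \<in> edges n \<Longrightarrow> (\<Sum>i\<in>I. matching_weight n (S i) e) = (if e \<in> C0 then \<gamma> else chord_weight n k)"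
proof -
  obtain p where p: "bij_betw p {..<n} {1..n}" and C0: "C0 = {{p i, p (Suc i mod n)} | i. i < n}"
    using assms(2) by (auto simp: ham_cycles_def)
  define m where "m = n div 2"
  define Ks where "Ks = {K. K \<subseteq> {..<m} \<and> card K = k}"
  define q where "q r a = p ((r + a) mod n)" for r a
  define S where "S = (\<lambda>(r, K). (\<lambda>i. {q r (2 * i), q r (2 * i + 1)}) ` K)"
  define V where "V a b = (\<Sum>K\<in>Ks. block_weight n K a b)" for a b
  have finKs: "finite Ks" by (simp add: Ks_def)
  have n0: "n > 0" using assms(1) by simp
  have q: "bij_betw (q r) {..<n} {1..n}" if "r < n" for r
  proof -
    have "bij_betw (\<lambda>a. (r + a) mod n) {..<n} {..<n}"
      using that n0 offset_simps(1-3)[OF _ that]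
      by (intro bij_betw_byWitness[where f' = "\<lambda>x. offset n x r"]) auto
    from bij_betw_trans[OF this p] show ?thesis
      unfolding q_def comp_def .
  qed
  have q_Suc: "{q r a, q r (Suc a)} \<in> C0" for r a
  proof -
    have "q r (Suc a) = p (Suc ((r + a) mod n) mod n)" by (simp only: q_def mod_Suc_eq add_Suc_right)
    moreover have "{p i, p (Suc i mod n)} \<in> C0" if "i < n" for i
      unfolding C0 using that by (intro CollectI exI[of _ i]) simp
    ultimately show ?thesis
      using n0 by (simp only: q_def mod_less_divisor)
  qed
  have p_q: "p x = q r (offset n x r)" "offset n x r < n" if "x < n" "r < n" for x r
    using offset_simps(1,2)[OF that] by (simp_all only: q_def)
  have weight: "(\<Sum>i\<in>{..<n} \<times> Ks. matching_weight n (S i) {p x, p y}) = (\<Sum>r<n. V (offset n x r) (offset n y r))"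
    if xy: "x < n" "y < n" "x \<noteq> y" for x y
  proof -
    have "matching_weight n (S (r, K)) {p x, p y} = block_weight n K (offset n x r) (offset n y r)"
      if r: "r < n" and K: "K \<in> Ks" for r K
    proof -
      have "offset n x r \<noteq> offset n y r"
        using xy r by (metis offset_simps(2))
      moreover have "K \<subseteq> {..<n div 2}" using K by (simp add: Ks_def m_def)
      ultimately show ?thesis
        unfolding p_q(1)[OF xy(1) r] p_q(1)[OF xy(2) r] S_def prod.case
        using block_matching(3)[OF q[OF r]] p_q(2)[OF xy(1) r] p_q(2)[OF xy(2) r] by blast
    qed
    then show ?thesis
      unfolding V_def sum.cartesian_product by (intro sum.cong refl) auto
  qed
  \<comment> \<open>Consecutive vertices stay consecutive from every starting point, so reindexing
    by position removes \<open>x\<close> from the sum. The common value is left unevaluated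
    here.\<close>
  have cyc: "(\<Sum>i\<in>{..<n} \<times> Ks. matching_weight n (S i) {p x, p (Suc x mod n)}) = (\<Sum>a<n. V a (Suc a mod n))"
    if x: "x < n" for x
  proof -
    have "x \<noteq> Suc x mod n" using x assms(1) by (cases "Suc x = n") auto
    then have "(\<Sum>i\<in>{..<n} \<times> Ks. matching_weight n (S i) {p x, p (Suc x mod n)})
        = (\<Sum>r<n. V (offset n x r) (offset n (Suc x mod n) r))"
      using x n0 by (intro weight) auto
    also have "\<dots> = (\<Sum>r<n. V (offset n x r) (Suc (offset n x r) mod n))"
      using x by (intro sum.cong refl) (simp only: offset_simps(5) lessThan_iff)
    also have "\<dots> = (\<Sum>a<n. V a (Suc a mod n))"
      by (rule sum_offset[OF x])
    finally show ?thesis .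
  qed
  have chord: "(\<Sum>i\<in>{..<n} \<times> Ks. matching_weight n (S i) {p x, p y}) = chord_weight n k"
    if xy: "x < n" "y < n" "x \<noteq> y" and nC: "{p x, p y} \<notin> C0" for x y
  proof -
    let ?c = "\<lambda>t. real ((m - t) choose k)"
    let ?odd = "\<lambda>a. of_bool (a div 2 = m) :: real"
    have V: "V (offset n x r) (offset n y r)
        = ?c 0 + 2 * ?c 1 + ?c 2 + (?odd (offset n x r) + ?odd (offset n y r)) * (?c 0 - ?c 2)"
      if r: "r < n" for r
    proof -
      let ?a = "offset n x r" and ?b = "offset n y r"
      have neq: "?a \<noteq> ?b" using xy r by (metis offset_simps(2))
      have "{q r ?a, q r ?b} \<notin> C0"
        using nC unfolding p_q(1)[OF xy(1) r] p_q(1)[OF xy(2) r] .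
      \<comment> \<open>Two positions in one block are consecutive, and consecutive vertices are
        joined by an edge of \<open>C0\<close>.\<close>
      then have "?b \<noteq> Suc ?a" "?a \<noteq> Suc ?b"
        using q_Suc[of r ?a] q_Suc[of r ?b] by (auto simp: insert_commute)
      with neq have d: "?a div 2 \<noteq> ?b div 2" by presburger
      have le: "?a div 2 \<le> m" "?b div 2 \<le> m"
        using p_q(2)[OF xy(1) r] p_q(2)[OF xy(2) r] by (auto simp: m_def)
      show ?thesis
        unfolding V_def Ks_def block_weight_def using sum_subsets_avoiding[OF d le, of k] d by simp
    qed
    \<comment> \<open>The number of starting points that leave a given vertex over: one for odd
      \<open>n\<close>, none for even \<open>n\<close>.\<close>
    have odd: "(\<Sum>r<n. ?odd (offset n x r)) = real n - 2 * real m" if "x < n" for x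
    proof -
      have "(\<Sum>r<n. ?odd (offset n x r)) = (\<Sum>a<n. ?odd a)"
        by (rule sum_offset[OF that])
      also have "\<dots> = real (card {a\<in>{..<n}. a div 2 = m})"
        by (simp add: Int_def)
      also have "{a\<in>{..<n}. a div 2 = m} = {2 * m..<n}"
        by (auto simp: m_def)
      finally show ?thesis by (simp add: m_def of_nat_diff)
    qed
    have "(\<Sum>i\<in>{..<n} \<times> Ks. matching_weight n (S i) {p x, p y})
        = (\<Sum>r<n. ?c 0 + 2 * ?c 1 + ?c 2 + (?odd (offset n x r) + ?odd (offset n y r)) * (?c 0 - ?c 2))"
      unfolding weight[OF xy] by (intro sum.cong refl V) simp
    also have "\<dots> = real n * (?c 0 + 2 * ?c 1 + ?c 2)
        + ((\<Sum>r<n. ?odd (offset n x r)) + (\<Sum>r<n. ?odd (offset n y r))) * (?c 0 - ?c 2)"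
      by (simp only: sum.distrib sum_distrib_right[symmetric]) (simp add: algebra_simps)
    finally show ?thesis
      unfolding odd[OF xy(1)] odd[OF xy(2)] by (simp add: chord_weight_def m_def Let_def)
  qed
  show thesis
  proof (rule that[of "{..<n} \<times> Ks" S "\<Sum>a<n. V a (Suc a mod n)"])
    show "finite ({..<n} \<times> Ks)" using finKs by simp
    show "card ({..<n} \<times> Ks) = n * ((n div 2) choose k)"
      by (simp add: card_cartesian_product Ks_def m_def n_subsets)
    show "S i \<subseteq> C0 \<and> pairwise disjnt (S i) \<and> card (S i) = k" if i: "i \<in> {..<n} \<times> Ks" for i
    proof -
      obtain r K where rK: "i = (r, K)" "r < n" "K \<subseteq> {..<n div 2}" "card K = k"
        using i by (auto simp: Ks_def m_def)
      then show ?thesis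
        using block_matching(1,2)[OF q[OF rK(2)] rK(3)] q_Suc by (auto simp: S_def)
    qed
    fix e assume "e \<in> edges n"
    then obtain u v where e: "e = {u, v}" "u \<noteq> v" "u \<in> {1..n}" "v \<in> {1..n}"
      by (auto simp: edges_def card_2_iff)
    obtain x y where xy: "x < n" "y < n" "u = p x" "v = p y"
      using e(3,4) bij_betw_imp_surj_on[OF p] by (metis imageE lessThan_iff)
    show "(\<Sum>i\<in>{..<n} \<times> Ks. matching_weight n (S i) e)
        = (if e \<in> C0 then \<Sum>a<n. V a (Suc a mod n) else chord_weight n k)"
    proof (cases "e \<in> C0")
      case True
      then obtain z where "z < n" "e = {p z, p (Suc z mod n)}" by (auto simp: C0)
      then show ?thesis using True cyc by simp
    next
      case False
      then have "{p x, p y} \<notin> C0" "x \<noteq> y" using e xy by auto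
      then show ?thesis using chord[OF xy(1,2)] False e(1) xy(3,4) by simp
    qed
  qed
qed

section \<open>Incidence vectors, linear functions and monomial test polynomials\<close>

lemma inj_on_incidence: "inj_on (\<lambda>C e. if e \<in> C then 1 else 0 :: real) A"
proof (rule inj_onI)
  fix C D :: "'b set"
  assume "(\<lambda>e. if e \<in> C then 1 else 0 :: real) = (\<lambda>e. if e \<in> D then 1 else 0)"
  then have "e \<in> C \<longleftrightarrow> e \<in> D" for e
    by (metis zero_neq_one)
  then show "C = D" by blast
qed

lemma avg_HX: "avg (HX n) g = (\<Sum>C\<in>ham_cycles n. g (\<lambda>e. if e \<in> C then 1 else 0)) / real (card (ham_cycles n))"
  unfolding avg_def HX_def
  by (simp add: sum.reindex[OF inj_on_incidence] card_image[OF inj_on_incidence])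

lemma lin_fun_incidence:
  assumes "C \<in> ham_cycles n" "n \<ge> 2"
  shows "lin_fun n c (\<lambda>e. if e \<in> C then 1 else 0) = (\<Sum>e\<in>C. c e)"
proof -
  have "(\<Sum>e\<in>C. c e) = (\<Sum>e\<in>edges n. if e \<in> C then c e else 0)"
    using ham_cycles_subset_edges[OF assms] finite_edges
    by (simp add: sum.If_cases Int_absorb1)
  then show ?thesis
    unfolding lin_fun_def by (simp add: if_distrib[of "(*) _"] cong: if_cong)
qed

lemma card_ham_cycle:
  assumes "C \<in> ham_cycles n" "n \<ge> 3"
  shows "card C = n"
proof -
  obtain \<pi> where "\<pi> permutes {1..n}" "C = perm_cycle n \<pi>"
    using assms by (auto simp: ham_cycles_eq)
  then show ?thesis
    using card_image[OF inj_on_perm_edge[OF permutes_inj assms(2)]] by (simp add: perm_cycle_def)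
qed

lemma finite_msets_size_le:
  assumes "finite A"
  shows "finite {m. set_mset m \<subseteq> A \<and> size m \<le> k}"
proof (rule finite_subset)
  show "{m. set_mset m \<subseteq> A \<and> size m \<le> k} \<subseteq> mset ` {xs. set xs \<subseteq> A \<and> length xs \<le> k}"
  proof
    fix m assume "m \<in> {m. set_mset m \<subseteq> A \<and> size m \<le> k}"
    moreover obtain xs where "mset xs = m" using ex_mset by blast
    ultimately show "m \<in> mset ` {xs. set xs \<subseteq> A \<and> length xs \<le> k}" by force
  qed
  show "finite (mset ` {xs. set xs \<subseteq> A \<and> length xs \<le> k})"
    using assms by (intro finite_imageI finite_lists_length_le)
qed

lemma poly_le_monomial:
  assumes "S \<subseteq> edges n" "card S \<le> k"
  shows "poly_le n k (\<lambda>x. \<Prod>e\<in>S. x e)"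
proof -
  let ?M = "{m. set_mset m \<subseteq> edges n \<and> size m \<le> k}"
  have finS: "finite S" using assms(1) finite_edges finite_subset by blast
  have mem: "mset_set S \<in> ?M" using assms finS by simp
  have "(\<Prod>e\<in>S. x e) = (\<Sum>m\<in>?M. of_bool (m = mset_set S) * (\<Prod>e\<in>#m. x e))" for x :: "nat set \<Rightarrow> real"
  proof -
    have "(\<Sum>m\<in>?M. of_bool (m = mset_set S) * (\<Prod>e\<in>#m. x e))
        = (\<Sum>m\<in>?M. if m = mset_set S then \<Prod>e\<in>#m. x e else 0)"
      by (intro sum.cong) auto
    also have "\<dots> = (\<Prod>e\<in>#mset_set S. x e)"
      using mem finite_msets_size_le[OF finite_edges] by (subst sum.delta) auto
    finally show ?thesis by (simp add: prod_unfold_prod_mset)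
  qed
  then show ?thesis
    unfolding poly_le_def by (intro exI[of _ "\<lambda>m. of_bool (m = mset_set S)"] allI)
qed

text \<open>On incidence vectors the monomial of \<open>S\<close> is the indicator of containing
  \<open>S\<close>, hence equal to its own square; the form evaluated at it is this sum up to a
  positive factor.\<close>

lemma Pset_sum_nonneg:
  assumes f: "f \<in> Pset n k" "n \<ge> 2" and S: "S \<subseteq> edges n" "card S \<le> k"
  shows "(\<Sum>C\<in>{C\<in>ham_cycles n. S \<subseteq> C}. f (\<lambda>e. if e \<in> C then 1 else 0)) \<ge> 0"
proof -
  let ?ind = "\<lambda>C e. if e \<in> C then 1 else 0 :: real"
  have finS: "finite S" using S(1) finite_edges finite_subset by blast
  have fin: "finite (ham_cycles n)" using f(2) finite_ham_cycles by simp
  have prod: "(\<Prod>e\<in>S. ?ind C e)^2 = of_bool (S \<subseteq> C)" for C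
    using finS by (cases "S \<subseteq> C") (auto simp: subset_iff intro: prod.neutral)
  have "0 \<le> qform n f (\<lambda>x. \<Prod>e\<in>S. x e)"
    using f(1) poly_le_monomial[OF S] by (auto simp: Pset_def)
  also have "\<dots> = (\<Sum>C\<in>ham_cycles n. f (?ind C) * of_bool (S \<subseteq> C)) / real (card (ham_cycles n))"
    unfolding qform_def avg_HX prod ..
  also have "(\<Sum>C\<in>ham_cycles n. f (?ind C) * of_bool (S \<subseteq> C)) = (\<Sum>C\<in>{C\<in>ham_cycles n. S \<subseteq> C}. f (?ind C))"
    using fin by (intro sum.mono_neutral_cong_right) auto
  finally have *: "0 \<le> (\<Sum>C\<in>{C\<in>ham_cycles n. S \<subseteq> C}. f (?ind C)) / real (card (ham_cycles n))" .
  show ?thesis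
  proof (cases "ham_cycles n = {}")
    case False
    then have "real (card (ham_cycles n)) > 0" using fin by (simp add: card_gt_0_iff)
    with * show ?thesis by (simp only: zero_le_divide_iff) linarith
  qed simp
qed

section \<open>Estimating the scaling constant\<close>

text \<open>\<open>D\<close> will be the excess of the total weight of an edge of the cycle over
  that of a chord. The coefficient \<open>\<lambda>\<close> of the averaging argument is
  \<open>D / (2 * n * (n - 1 - k) * b)\<close>, so the second claim says
  \<open>1 / \<lambda> \<le> n / k + 10 / n\<close>.\<close>

lemma chord_weight_bound:
  assumes "n \<ge> 9" "1 \<le> k" "k \<le> n div 2"
  defines "b \<equiv> real ((n div 2) choose k)"
  defines "D \<equiv> 2 * real n * (real n - 1 - real k) * b - (real n - 1) / 2 * chord_weight n k"
  shows "D > 0" "2 * real n * (real n - 1 - real k) * b \<le> (real n / real k + 10 / real n) * D"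
proof -
  define m where "m = n div 2"
  define x y :: real where "x = real n" and "y = real k"
  have m: "m \<ge> 4" "k \<le> m" using assms by (auto simp: m_def)
  have b0: "b > 0" using m by (simp add: b_def m_def)
  have xy: "x \<ge> 9" "y \<ge> 1" "2 * y \<le> x" using assms by (auto simp: x_def y_def)
  have c1: "real ((m - 1) choose k) = (real m - y) / real m * b"
  proof -
    have "real (m - k) * b = real m * real ((m - 1) choose k)"
      using binomial_absorb_comp[of m k] unfolding b_def m_def[symmetric] by (metis of_nat_mult)
    then show ?thesis using m by (simp add: field_simps of_nat_diff y_def)
  qed
  have c2: "real ((m - 2) choose k) = (real m - 1 - y) * (real m - y) / ((real m - 1) * real m) * b"
  proof -
    have "real (m - 1 - k) * real ((m - 1) choose k) = real (m - 1) * real ((m - 2) choose k)"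
      using binomial_absorb_comp[of "m - 1" k] by (metis of_nat_mult diff_diff_left one_add_one)
    \<comment> \<open>For \<open>k = m\<close> the natural number \<open>m - 1 - k\<close> is
      truncated to \<open>0\<close>, but then the binomial coefficient vanishes as well.\<close>
    moreover have "real (m - 1 - k) * real ((m - 1) choose k) = (real m - 1 - y) * real ((m - 1) choose k)"
      using m by (cases "k = m") (auto simp: of_nat_diff y_def)
    moreover have "real (m - 1) = real m - 1" using m by simp
    ultimately have "(real m - 1 - y) * real ((m - 1) choose k) = (real m - 1) * real ((m - 2) choose k)" by simp
    then show ?thesis using m unfolding c1 by (simp add: field_simps)
  qed
  \<comment> \<open>Both parities bring \<open>D\<close> to the form
    \<open>2 * y * b * E / z\<close>, with \<open>z = x - 2\<close> for even and
    \<open>z = x - 3\<close> for odd \<open>n\<close>. The leading terms of the two sides then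
    cancel, and their difference is a positive multiple of
    \<open>10 * y * E - x^2 * (y - 1)\<close>.\<close>
  have red: "D > 0 \<and> 2 * real n * (real n - 1 - real k) * b \<le> (real n / real k + 10 / real n) * D"
    if D: "D * z = 2 * y * b * E" and z: "z > 0" "E > 0" "E = (x - 1 - y) * z - (y - 1)"
      and E: "10 * y * E \<ge> x^2 * (y - 1)" for z E
  proof -
    have D': "D = 2 * y * b * E / z" using D z(1) by (simp add: eq_divide_eq)
    have "x - 1 - y = (E + y - 1) / z"
      using z(1) unfolding z(3) by simp
    then have "(x / y + 10 / x) * D - 2 * x * (x - 1 - y) * b
        = (x / y + 10 / x) * (2 * y * b * E / z) - 2 * x * ((E + y - 1) / z) * b"
      by (simp only: D')
    also have "\<dots> = 2 * b / (x * z) * (10 * y * E - x^2 * (y - 1))"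
      using xy z(1) by (simp add: field_simps power2_eq_square)
    also have "\<dots> \<ge> 0" using b0 xy z E by simp
    finally show ?thesis
      unfolding D' using b0 xy z by (simp add: x_def y_def)
  qed
  have tau: "chord_weight n k = b * (x * (1 + 2 * ((real m - y) / real m)
       + (real m - 1 - y) * (real m - y) / ((real m - 1) * real m))
     + 2 * (x - 2 * real m) * (1 - (real m - 1 - y) * (real m - y) / ((real m - 1) * real m)))"
    unfolding chord_weight_def Let_def m_def[symmetric] c1 c2 x_def[symmetric]
    by (simp add: b_def m_def algebra_simps)
  \<comment> \<open>Expanded around \<open>9\<close>, the smallest admissible value of
    \<open>x\<close>, the difference of the two sides has only positive coefficients.\<close>
  have k1: "x^2 \<le> 5 * (x - 2) * (x - 4)"
  proof -
    have "0 \<le> 4 * (x - 9)^2 + 42 * (x - 9) + 94"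
      using xy(1) by (intro add_nonneg_nonneg) simp_all
    also have "\<dots> = 5 * (x - 2) * (x - 4) - x^2"
      by (simp add: power2_eq_square algebra_simps)
    finally show ?thesis by simp
  qed
  have "D > 0 \<and> 2 * real n * (real n - 1 - real k) * b \<le> (real n / real k + 10 / real n) * D"
  proof (cases "even n")
    case True
    then have "n = 2 * m" by (simp add: m_def)
    then have mx: "real m = x / 2" by (simp add: x_def)
    \<comment> \<open>This \<open>?E\<close> decreases in \<open>y\<close>, so
      \<open>y = x / 2\<close> gives the lower bound \<open>(x - 2) * (x - 3) / 2\<close>. It is
      weakened to \<open>(x - 2) * (x - 4) / 2\<close>, the bound that also comes out for odd
      \<open>n\<close>.\<close>
    let ?E = "(x - 2)^2 - (x - 1) * (y - 1)"
    have "(x - 1) * (y - 1) \<le> (x - 1) * ((x - 2) / 2)"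
      using xy by (intro mult_left_mono) auto
    then have "(x - 2)^2 - (x - 1) * ((x - 2) / 2) \<le> ?E" by simp
    moreover have "(x - 2) * (x - 4) / 2 = (x - 2)^2 - (x - 1) * ((x - 2) / 2) - (x - 2) / 2"
      by (simp add: power2_eq_square field_simps)
    ultimately have E1: "?E \<ge> (x - 2) * (x - 4) / 2"
      using xy(1) by argo
    have "(x - 2) * (x - 4) / 2 > 0" using xy by simp
    show ?thesis
    proof (rule red[of "x - 2" ?E])
      show "D * (x - 2) = 2 * y * b * ?E"
        unfolding D_def tau mx using xy
        by (simp add: x_def[symmetric] y_def[symmetric] field_simps power2_eq_square)
      show "?E > 0" using E1 \<open>(x - 2) * (x - 4) / 2 > 0\<close> by linarith
      show "?E = (x - 1 - y) * (x - 2) - (y - 1)" by (simp add: power2_eq_square algebra_simps)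
      have "x^2 * (y - 1) \<le> (5 * (x - 2) * (x - 4)) * y"
        using k1 xy by (intro mult_mono) auto
      also have "\<dots> = 10 * y * ((x - 2) * (x - 4) / 2)" by simp
      also have "\<dots> \<le> 10 * y * ?E" using E1 xy by (intro mult_left_mono) auto
      finally show "10 * y * ?E \<ge> x^2 * (y - 1)" .
    qed (use xy in simp)
  next
    case False
    then have "n = 2 * m + 1" by (simp add: m_def)
    then have mx: "real m = (x - 1) / 2" by (simp add: x_def)
    \<comment> \<open>With \<open>z = x - 3\<close> the denominators coming from
      \<open>m - 1\<close> and \<open>m\<close> are \<open>z\<close> and \<open>z + 2\<close> up to
      constants.\<close>
    obtain z where z: "x = z + 3" by (metis diff_add_cancel)
    have z6: "z \<ge> 6" using xy(1) by (simp add: z)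
    then have nz: "z \<noteq> 0" "z + 2 \<noteq> 0" by simp_all
    have mz: "real m - 1 = z / 2" "real m = (z + 2) / 2"
      unfolding mx z by (simp_all add: field_simps)
    have r: "(real m - y) / real m = (z + 2 - 2 * y) / (z + 2)"
      "(real m - 1 - y) * (real m - y) / ((real m - 1) * real m) = (z - 2 * y) * (z + 2 - 2 * y) / (z * (z + 2))"
      unfolding mz using nz by (simp_all add: divide_simps) (simp_all add: algebra_simps)
    let ?E = "(x - 2) * (x - 2 - y)"
    have "(x - 2) * ((x - 4) / 2) \<le> ?E"
      using xy by (intro mult_left_mono) auto
    then have E1: "?E \<ge> (x - 2) * (x - 4) / 2" by simp
    have "(x - 2) * (x - 4) / 2 > 0" using xy by simp
    show ?thesis
    proof (rule red[of "x - 3" ?E])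
      show "D * (x - 3) = 2 * y * b * ?E"
        unfolding D_def tau r x_def[symmetric] y_def[symmetric] mx z using z6
        by (simp add: nz divide_simps) (simp add: algebra_simps)
      show "?E > 0" using E1 \<open>(x - 2) * (x - 4) / 2 > 0\<close> by linarith
      show "?E = (x - 1 - y) * (x - 3) - (y - 1)" by (simp add: algebra_simps)
      have "x^2 * (y - 1) \<le> (5 * (x - 2) * (x - 4)) * y"
        using k1 xy by (intro mult_mono) auto
      also have "\<dots> = 10 * y * ((x - 2) * (x - 4) / 2)" by simp
      also have "\<dots> \<le> 10 * y * ?E" using E1 xy by (intro mult_left_mono) auto
      finally show "10 * y * ?E \<ge> x^2 * (y - 1)" .
    qed (use xy in simp)
  qed
  then show "D > 0" "2 * real n * (real n - 1 - real k) * b \<le> (real n / real k + 10 / real n) * D"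
    by blast+
qed

section \<open>The lower bound from the averaged matchings\<close>

text \<open>The conditional expectations are summed over all matchings in the cycle of
  \<open>x\<close>. As the total weight of an edge depends only on whether it lies on that cycle,
  what remains is a combination of \<open>f x\<close> and the sum of all coefficients, and the
  latter is fixed by the average of \<open>f\<close>.\<close>

lemma Pset_lower_bound:
  assumes n: "n \<ge> 9" and k: "1 \<le> k" "k \<le> n div 2" and f: "f \<in> Pset n k" and x: "x \<in> HX n"
  shows "f x \<ge> 1 - (real n / real k + 10 / real n)"
proof -
  let ?ind = "\<lambda>C e. if e \<in> C then 1 else 0 :: real"
  obtain c where c: "f = (\<lambda>x\<in>HX n. lin_fun n c x)" and avg: "avg (HX n) f = 1"
    using f by (auto simp: Pset_def)
  have f_ind: "f (?ind C) = (\<Sum>e\<in>C. c e)" if "C \<in> ham_cycles n" for C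
  proof -
    have "?ind C \<in> HX n" using that by (auto simp: HX_def)
    then show ?thesis using lin_fun_incidence[OF that] n by (simp add: c)
  qed
  obtain C0 where C0: "C0 \<in> ham_cycles n" "x = ?ind C0" using x by (auto simp: HX_def)
  have C0e: "C0 \<subseteq> edges n" using ham_cycles_subset_edges[OF C0(1)] n by simp
  have finH: "finite (ham_cycles n)" using finite_ham_cycles n by simp
  have card_pos: "card {C\<in>ham_cycles n. S \<subseteq> C} > 0" if "S \<subseteq> C0" for S
    using that C0(1) finH by (auto simp: card_gt_0_iff)
  \<comment> \<open>The case of the empty matching: each edge lies on a random cycle with
    probability \<open>2 / (n - 1)\<close>.\<close>
  have empty: "2 * (real n - 1) * (\<Sum>C\<in>ham_cycles n. \<Sum>e\<in>C. g e) = real (card (ham_cycles n)) * (4 * (\<Sum>e\<in>edges n. g e))"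
    for g
  proof -
    have "matching_weight n {} e = 4" if "e \<in> edges n" for e
      using that by (simp add: matching_weight_def edges_def)
    then have "(\<Sum>e\<in>edges n. g e * matching_weight n {} e) = (\<Sum>e\<in>edges n. 4 * g e)"
      by (intro sum.cong refl) simp
    also have "\<dots> = 4 * (\<Sum>e\<in>edges n. g e)"
      by (rule sum_distrib_left[symmetric])
    finally have "(\<Sum>e\<in>edges n. g e * matching_weight n {} e) = 4 * (\<Sum>e\<in>edges n. g e)" .
    then show ?thesis
      using sum_ham_cycles_matching[of n "{}" g] n by simp
  qed
  have total: "(\<Sum>C\<in>ham_cycles n. \<Sum>e\<in>C. g e) = real (card (ham_cycles n)) * s \<Longrightarrow> (\<Sum>e\<in>edges n. g e) = (real n - 1) / 2 * s"
    for g s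
  proof -
    let ?h = "real (card (ham_cycles n))"
    assume "(\<Sum>C\<in>ham_cycles n. \<Sum>e\<in>C. g e) = ?h * s"
    with empty[of g] have "?h * (2 * (real n - 1) * s) = ?h * (4 * (\<Sum>e\<in>edges n. g e))"
      by (simp only: mult.left_commute)
    then have "2 * (real n - 1) * s = 4 * (\<Sum>e\<in>edges n. g e)"
      using card_pos[of "{}"] by (subst (asm) mult_cancel_left) simp
    then show ?thesis by (simp add: field_simps)
  qed
  have sum_c: "(\<Sum>e\<in>edges n. c e) = (real n - 1) / 2"
  proof -
    have "(\<Sum>C\<in>ham_cycles n. \<Sum>e\<in>C. c e) = (\<Sum>C\<in>ham_cycles n. f (?ind C))"
      using f_ind by simp
    also have "\<dots> = real (card (ham_cycles n)) * 1"
      using avg card_pos[of "{}"] unfolding avg_HX by (simp add: divide_eq_eq)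
    finally show ?thesis using total by fastforce
  qed
  \<comment> \<open>Obtained from \<open>total\<close> with all coefficients \<open>1\<close>, since
    every cycle has \<open>n\<close> edges.\<close>
  have card_edges: "real (card (edges n)) = (real n - 1) / 2 * real n"
  proof -
    have "(\<Sum>C\<in>ham_cycles n. \<Sum>e\<in>C. 1) = real (card (ham_cycles n)) * real n"
      using card_ham_cycle n by simp
    from total[OF this] show ?thesis by simp
  qed
  have n4: "n \<ge> 4" using n by simp
  obtain I :: "(nat \<times> nat set) set" and S \<gamma> where I: "finite I" "card I = n * ((n div 2) choose k)"
    "\<And>i. i \<in> I \<Longrightarrow> S i \<subseteq> C0 \<and> pairwise disjnt (S i) \<and> card (S i) = k"
    "\<And>e. e \<in> edges n \<Longrightarrow> (\<Sum>i\<in>I. matching_weight n (S i) e) = (if e \<in> C0 then \<gamma> else chord_weight n k)"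
    by (rule matchings_of_ham_cycle[OF n4 C0(1), of k]) (rule that)
  define \<tau> where "\<tau> = chord_weight n k"
  define b where "b = real ((n div 2) choose k)"
  have sum_I: "(\<Sum>i\<in>I. \<Sum>e\<in>edges n. g e * matching_weight n (S i) e)
      = (\<gamma> - \<tau>) * (\<Sum>e\<in>C0. g e) + \<tau> * (\<Sum>e\<in>edges n. g e)" for g
  proof -
    have "(\<Sum>i\<in>I. \<Sum>e\<in>edges n. g e * matching_weight n (S i) e)
        = (\<Sum>e\<in>edges n. g e * (\<Sum>i\<in>I. matching_weight n (S i) e))"
      unfolding sum_distrib_left by (rule sum.swap)
    also have "\<dots> = (\<Sum>e\<in>edges n. (if e \<in> C0 then (\<gamma> - \<tau>) * g e else 0) + \<tau> * g e)"
      by (intro sum.cong refl) (simp add: I(4) \<tau>_def algebra_simps)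
    also have "\<dots> = (\<gamma> - \<tau>) * (\<Sum>e\<in>C0. g e) + \<tau> * (\<Sum>e\<in>edges n. g e)"
      using C0e finite_edges by (simp add: sum.distrib sum.If_cases Int_absorb1 sum_distrib_left)
    finally show ?thesis .
  qed
  define d where "d = 2 * (real n - 1 - real k)"
  have d0: "d > 0" using n k by (simp add: d_def)
  have rel: "d * (\<Sum>C\<in>{C\<in>ham_cycles n. S i \<subseteq> C}. \<Sum>e\<in>C. g e)
      = real (card {C\<in>ham_cycles n. S i \<subseteq> C}) * (\<Sum>e\<in>edges n. g e * matching_weight n (S i) e)"
    if "i \<in> I" for i g
  proof -
    have "S i \<subseteq> edges n" using I(3)[OF that] C0e by blast
    then show ?thesis
      using sum_ham_cycles_matching[of n "S i" g] I(3)[OF that] n by (simp add: d_def)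
  qed
  have nonneg: "0 \<le> (\<gamma> - \<tau>) * (\<Sum>e\<in>C0. c e) + \<tau> * (\<Sum>e\<in>edges n. c e)"
    unfolding sum_I[symmetric]
  proof (rule sum_nonneg)
    fix i assume i: "i \<in> I"
    have "0 \<le> (\<Sum>C\<in>{C\<in>ham_cycles n. S i \<subseteq> C}. f (?ind C))"
      using Pset_sum_nonneg[OF f, of "S i"] I(3)[OF i] C0e n by auto
    also have "\<dots> = (\<Sum>C\<in>{C\<in>ham_cycles n. S i \<subseteq> C}. \<Sum>e\<in>C. c e)"
      using f_ind by (intro sum.cong) auto
    finally have "0 \<le> real (card {C\<in>ham_cycles n. S i \<subseteq> C}) * (\<Sum>e\<in>edges n. c e * matching_weight n (S i) e)"
      using rel[OF i, of c] d0 by (metis less_imp_le mult_nonneg_nonneg)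
    then show "0 \<le> (\<Sum>e\<in>edges n. c e * matching_weight n (S i) e)"
      using card_pos[of "S i"] I(3)[OF i] by (simp add: zero_le_mult_iff)
  qed
  \<comment> \<open>With coefficients \<open>1\<close> every cycle has value \<open>n\<close>, so
    each matching has total weight \<open>d * n\<close>. Comparing this with the edgewise totals
    determines \<open>\<gamma> - \<tau>\<close> without evaluating \<open>\<gamma>\<close>.\<close>
  have "(\<Sum>i\<in>I. \<Sum>e\<in>edges n. 1 * matching_weight n (S i) e) = (\<Sum>i\<in>I. d * real n)"
  proof (intro sum.cong refl)
    fix i assume i: "i \<in> I"
    have "(\<Sum>C\<in>{C\<in>ham_cycles n. S i \<subseteq> C}. \<Sum>e\<in>C. 1) = (\<Sum>C\<in>{C\<in>ham_cycles n. S i \<subseteq> C}. real n)"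
      using card_ham_cycle n by (intro sum.cong refl) simp
    also have "\<dots> = real (card {C\<in>ham_cycles n. S i \<subseteq> C}) * real n" by simp
    finally have "(\<Sum>C\<in>{C\<in>ham_cycles n. S i \<subseteq> C}. \<Sum>e\<in>C. 1) = real (card {C\<in>ham_cycles n. S i \<subseteq> C}) * real n" .
    with rel[OF i, of "\<lambda>_. 1"] show "(\<Sum>e\<in>edges n. 1 * matching_weight n (S i) e) = d * real n"
      using card_pos[of "S i"] I(3)[OF i] by simp
  qed
  then have "(\<gamma> - \<tau>) * real n + \<tau> * ((real n - 1) / 2 * real n) = real n * b * (d * real n)"
    unfolding sum_I using card_ham_cycle[OF C0(1)] n I(2) by (simp add: card_edges b_def)
  then have "real n * ((\<gamma> - \<tau>) + \<tau> * ((real n - 1) / 2)) = real n * (b * (d * real n))"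
    by (simp add: algebra_simps)
  then have D: "\<gamma> - \<tau> = 2 * real n * (real n - 1 - real k) * b - (real n - 1) / 2 * \<tau>"
  proof -
    assume "real n * ((\<gamma> - \<tau>) + \<tau> * ((real n - 1) / 2)) = real n * (b * (d * real n))"
    then have "(\<gamma> - \<tau>) + \<tau> * ((real n - 1) / 2) = b * (d * real n)"
      using n by (subst (asm) mult_cancel_left) simp
    then show ?thesis by (simp add: d_def algebra_simps)
  qed
  note bound = chord_weight_bound[OF n k, folded b_def \<tau>_def, folded D]
  have "f x = (\<Sum>e\<in>C0. c e)" using f_ind[OF C0(1)] C0(2) by simp
  then have "0 \<le> (\<gamma> - \<tau>) * f x + (2 * real n * (real n - 1 - real k) * b - (\<gamma> - \<tau>))"
    using nonneg unfolding sum_c D by (simp add: algebra_simps)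
  also have "\<dots> \<le> (\<gamma> - \<tau>) * f x + ((real n / real k + 10 / real n) * (\<gamma> - \<tau>) - (\<gamma> - \<tau>))"
    using bound(2) by simp
  also have "\<dots> = (\<gamma> - \<tau>) * (f x - 1 + (real n / real k + 10 / real n))"
    by (simp add: algebra_simps)
  finally show ?thesis
    using bound(1) by (simp add: zero_le_mult_iff)
qed

section \<open>The two inclusions\<close>

theorem theorem1:
  fixes n k :: nat
  assumes "n \<ge> 9" and "1 \<le> k" and "k \<le> n div 2"
  shows "\<exists>a \<alpha> :: real. a = real n / real k + \<alpha> \<and> \<bar>\<alpha>\<bar> \<le> 10 / real n
           \<and> shift1 n (Qset n) \<subseteq> shift1 n (Pset n k)
           \<and> shift1 n (Pset n k) \<subseteq> scaleS n a (shift1 n (Qset n))"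
proof (intro exI conjI)
  let ?a = "real n / real k + 10 / real n"
  show "?a = real n / real k + 10 / real n" "\<bar>10 / real n\<bar> \<le> 10 / real n" by simp_all
  have a0: "?a > 0" using assms by (intro add_pos_pos divide_pos_pos) auto
  have "Qset n \<subseteq> Pset n k"
  proof
    fix f assume "f \<in> Qset n"
    then obtain c where "f = (\<lambda>x\<in>HX n. lin_fun n c x)" "\<forall>x\<in>HX n. f x \<ge> 0" "avg (HX n) f = 1"
      unfolding Qset_def by blast
    moreover from this(2) have "qform n f h \<ge> 0" for h
      unfolding qform_def avg_def by (intro divide_nonneg_nonneg sum_nonneg mult_nonneg_nonneg) auto
    ultimately show "f \<in> Pset n k"
      unfolding Pset_def by blast
  qed
  then show "shift1 n (Qset n) \<subseteq> shift1 n (Pset n k)"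
    unfolding shift1_def by (rule image_mono)
  show "shift1 n (Pset n k) \<subseteq> scaleS n ?a (shift1 n (Qset n))"
  proof
    fix u assume "u \<in> shift1 n (Pset n k)"
    then obtain f where f: "f \<in> Pset n k" and u: "u = (\<lambda>x\<in>HX n. f x - 1)"
      by (auto simp: shift1_def)
    obtain c where c: "f = (\<lambda>x\<in>HX n. lin_fun n c x)" and avg: "avg (HX n) f = 1"
      using f by (auto simp: Pset_def)
    \<comment> \<open>The solution of \<open>f - 1 = ?a * (g - 1)\<close>; the lower bound on
      \<open>f\<close> says exactly that \<open>g\<close> is nonnegative.\<close>
    define g where "g = (\<lambda>x\<in>HX n. 1 + (f x - 1) / ?a)"
    have finH: "finite (ham_cycles n)" using finite_ham_cycles assms(1) by simp
    \<comment> \<open>A constant is a linear function on \<open>HX n\<close>: every cycle has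
      \<open>n\<close> edges, so \<open>1 - 1 / ?a\<close> is spread evenly as
      \<open>(1 - 1 / ?a) / n\<close> over the edges.\<close>
    have "lin_fun n (\<lambda>e. (1 - 1 / ?a) / real n + c e / ?a) x = 1 + (f x - 1) / ?a" if x: "x \<in> HX n" for x
    proof -
      obtain C where C: "C \<in> ham_cycles n" "x = (\<lambda>e. if e \<in> C then 1 else 0)"
        using x by (auto simp: HX_def)
      have L: "lin_fun n d x = (\<Sum>e\<in>C. d e)" for d
        using lin_fun_incidence[OF C(1)] assms(1) C(2) by simp
      have "lin_fun n (\<lambda>e. (1 - 1 / ?a) / real n + c e / ?a) x
          = real (card C) * ((1 - 1 / ?a) / real n) + lin_fun n c x / ?a"
        unfolding L by (simp only: sum.distrib sum_constant sum_divide_distrib)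
      also have "\<dots> = (1 - 1 / ?a) + f x / ?a"
        using card_ham_cycle[OF C(1)] assms(1) x by (simp add: c)
      finally show ?thesis by (simp add: diff_divide_distrib)
    qed
    then have g: "g = (\<lambda>x\<in>HX n. lin_fun n (\<lambda>e. (1 - 1 / ?a) / real n + c e / ?a) x)"
      unfolding g_def by (intro restrict_ext) simp
    have "avg (HX n) g = 1"
    proof -
      \<comment> \<open>Over an empty \<open>HX n\<close> the average would be \<open>0\<close>, by
        the convention for division by zero.\<close>
      have card0: "real (card (HX n)) \<noteq> 0" using avg by (auto simp: avg_def)
      have "(\<Sum>x\<in>HX n. g x) = (\<Sum>x\<in>HX n. 1 + (f x - 1) / ?a)"
        by (intro sum.cong) (simp_all add: g_def)
      also have "\<dots> = real (card (HX n)) + ((\<Sum>x\<in>HX n. f x) - real (card (HX n))) / ?a"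
        by (simp only: sum.distrib sum_constant sum_divide_distrib[symmetric] sum_subtractf mult_1_right)
      also have "(\<Sum>x\<in>HX n. f x) = real (card (HX n))"
        using avg card0 by (simp add: avg_def)
      finally show ?thesis using card0 by (simp add: avg_def)
    qed
    moreover have "\<forall>x\<in>HX n. g x \<ge> 0"
    proof
      fix x assume x: "x \<in> HX n"
      have "- ?a \<le> f x - 1" using Pset_lower_bound[OF assms f x] by linarith
      then have "- 1 \<le> (f x - 1) / ?a"
        using a0 by (subst pos_le_divide_eq) simp_all
      then show "g x \<ge> 0" using x unfolding g_def by simp
    qed
    ultimately have "g \<in> Qset n" using g unfolding Qset_def by blast
    then have mem: "(\<lambda>x\<in>HX n. g x - 1) \<in> shift1 n (Qset n)" by (auto simp: shift1_def)
    have eq: "u = (\<lambda>x\<in>HX n. ?a * (\<lambda>x\<in>HX n. g x - 1) x)"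
      unfolding u using a0 by (intro restrict_ext) (simp add: g_def)
    show "u \<in> scaleS n ?a (shift1 n (Qset n))"
      unfolding scaleS_def by (rule image_eqI[OF _ mem]) (rule eq)
  qed
qed

end
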